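(* Fix $d\in\mathbf{N}$. No curve $(\mu_\alpha)_{\alpha>0}$ of optimizers $$\mu_\alpha\in\operatorname{argmax}_{\mathcal{P}(\mathbf{S}^d)}E_\alpha$$ can be $d_\infty$-continuous at $\alpha=\alpha_{\Delta^d}$, except possibly if $\alpha_{\Delta^d}=1$.
   Context: $\mathbf{N}=\{1,2,\ldots\}$. $\mathbf{S}^d=\{x\in\mathbf{R}^{d+1}: |x|=1\}$ with geodesic distance $\rho(x,y)=\arccos(x\cdot y)$; $\mathcal{P}(\mathbf{S}^d)$ is the set of Borel probability measures on $\mathbf{S}^d$. Put $\Lambda(x,y)=\frac{2}{\pi}\min\{\rho(x,y),\pi-\rho(x,y)\}$. For exponents $\alpha\in(0,\infty]$ set $E_\alpha(\mu)=\frac12\iint\Lambda^\alpha(x,y)\,d\mu(x)\,d\mu(y)$, where $\Lambda^\infty(x,y)=1$ if $x\cdot y=0$ and $0$ otherwise. $\mathcal{P}_\Delta^=(\mathbf{S}^d)$ is the set of $\mu\in\mathcal{P}(\mathbf{S}^d)$ for which there is an orthonormal basis $\{v_0,\ldots,v_d\}$ of $\mathbf{R}^{d+1}$ with $\mu(\{v_i,-v_i\})=\frac{1}{d+1}$ for every $i=0,\ldots,d$. $\operatorname{argmax}_{\mathcal{P}(\mathbf{S}^d)}E_\alpha$ is the set of all maximizers of $E_\alpha$ over $\mathcal{P}(\mathbf{S}^d)$. The threshold exponent $\alpha_{\Delta^d}$ is the unique element of $[1,\infty]$ such that $0<\alpha<\alpha_{\Delta^d}$ implies $\mathcal{P}_\Delta^=(\mathbf{S}^d)\cap\operatorname{argmax}_{\mathcal{P}(\mathbf{S}^d)}E_\alpha=\emptyset$,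 while $\alpha>\alpha_{\Delta^d}$ implies $\mathcal{P}_\Delta^=(\mathbf{S}^d)=\operatorname{argmax}_{\mathcal{P}(\mathbf{S}^d)}E_\alpha$ (existence and uniqueness of such an exponent hold, and it is finite). The $L^\infty$-Kantorovich-Rubinstein-Wasserstein distance is $d_\infty(\mu,\nu)=\inf_{\gamma\in\Gamma(\mu,\nu)}\sup_{(x,y)\in\operatorname{spt}\gamma}\rho(x,y)$, where $\Gamma(\mu,\nu)$ is the set of joint probability measures on $\mathbf{S}^d\times\mathbf{S}^d$ with left marginal $\mu$ and right marginal $\nu$, and $\operatorname{spt}\gamma$ is the smallest closed set of full $\gamma$-measure. A curve $(\mu_\alpha)_{\alpha>0}$ is a map $\alpha\in(0,\infty)\mapsto\mu_\alpha\in\mathcal{P}(\mathbf{S}^d)$. *)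

theory Defs
  imports "HOL-Probability.Probability"
begin

text \<open>
  The ambient space is \<open>real ^ 'n\<close>, so the unit sphere \<open>sphere 0 1\<close> has
  dimension \<open>CARD('n) - 1\<close>. Exponents range over \<open>ereal\<close>; only positive ones,
  including \<open>\<infinity>\<close>, are meaningful.
\<close>

definition sphere_borel :: "(real ^ 'n) measure" where
  "sphere_borel = restrict_space borel (sphere 0 1)"

definition sphere_probs :: "(real ^ 'n) measure set" where
  "sphere_probs = {\<mu>. prob_space \<mu> \<and> sets \<mu> = sets sphere_borel}"

definition geo_dist :: "real ^ 'n \<Rightarrow> real ^ 'n \<Rightarrow> real" where
  "geo_dist x y = arccos (x \<bullet> y)"

definition Lam :: "real ^ 'n \<Rightarrow> real ^ 'n \<Rightarrow> real" where
  "Lam x y = 2 / pi * min (geo_dist x y) (pi - geo_dist x y)"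

definition Lam_pow :: "ereal \<Rightarrow> real ^ 'n \<Rightarrow> real ^ 'n \<Rightarrow> real" where
  "Lam_pow \<alpha> x y =
     (if \<alpha> = \<infinity> then (if x \<bullet> y = 0 then 1 else 0) else Lam x y powr real_of_ereal \<alpha>)"

definition energy :: "ereal \<Rightarrow> (real ^ 'n) measure \<Rightarrow> real" where
  "energy \<alpha> \<mu> = 1 / 2 * (\<integral>x. (\<integral>y. Lam_pow \<alpha> x y \<partial>\<mu>) \<partial>\<mu>)"

definition energy_argmax :: "ereal \<Rightarrow> (real ^ 'n) measure set" where
  "energy_argmax \<alpha> =
     {\<mu> \<in> sphere_probs. \<forall>\<nu> :: (real ^ 'n) measure \<in> sphere_probs. energy \<alpha> \<nu> \<le> energy \<alpha> \<mu>}"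

definition orthonormal_basis :: "('n::finite \<Rightarrow> real ^ 'n) \<Rightarrow> bool" where
  "orthonormal_basis v \<longleftrightarrow>
     (\<forall>i j. v i \<bullet> v j = (if i = j then 1 else 0)) \<and> span (range v) = UNIV"

definition simplex_probs :: "(real ^ 'n) measure set" where
  "simplex_probs =
     {\<mu> \<in> sphere_probs. \<exists>v. orthonormal_basis v \<and>
        (\<forall>i. measure \<mu> {v i, - v i} = 1 / real CARD('n))}"

definition threshold_exponent :: "'n::finite itself \<Rightarrow> ereal" where
  "threshold_exponent _ = (THE a. 1 \<le> a \<and>
     (\<forall>\<alpha>. 0 < \<alpha> \<and> \<alpha> < a \<longrightarrow>
        (simplex_probs :: (real ^ 'n::finite) measure set) \<inter> energy_argmax \<alpha> = {}) \<and>
     (\<forall>\<alpha>. a < \<alpha> \<longrightarrow>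
        (simplex_probs :: (real ^ 'n::finite) measure set) = energy_argmax \<alpha>))"

definition couplings ::
  "(real ^ 'n) measure \<Rightarrow> (real ^ 'n) measure \<Rightarrow> ((real ^ 'n) \<times> (real ^ 'n)) measure set" where
  "couplings \<mu> \<nu> =
     {\<gamma>. prob_space \<gamma> \<and> sets \<gamma> = sets (sphere_borel \<Otimes>\<^sub>M sphere_borel) \<and>
        distr \<gamma> sphere_borel fst = \<mu> \<and> distr \<gamma> sphere_borel snd = \<nu>}"

definition spt :: "'a::topological_space measure \<Rightarrow> 'a set" where
  "spt \<gamma> = \<Inter>{C. closedin (top_of_set (space \<gamma>)) C \<and> emeasure \<gamma> C = emeasure \<gamma> (space \<gamma>)}"

definition d_inf :: "(real ^ 'n) measure \<Rightarrow> (real ^ 'n) measure \<Rightarrow> real" where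
  "d_inf \<mu> \<nu> = (INF \<gamma>\<in>couplings \<mu> \<nu>. SUP (x, y)\<in>spt \<gamma>. geo_dist x y)"

text \<open>
  A curve is indexed by \<open>(0,\<infinity>)\<close>: its values outside this interval play no role,
  and continuity at an exponent includes that the exponent belongs to the interval.
\<close>

definition d_inf_continuous_at :: "(real \<Rightarrow> (real ^ 'n) measure) \<Rightarrow> ereal \<Rightarrow> bool" where
  "d_inf_continuous_at \<mu> a \<longleftrightarrow>
     (\<exists>t>0. a = ereal t \<and> ((\<lambda>\<alpha>. d_inf (\<mu> \<alpha>) (\<mu> t)) \<longlongrightarrow> 0) (at t within {0<..}))"

end

theory Submission
  imports Defs
begin

text \<open>
  Raising the exponent lowers the energy, except for measures on which \<open>Lam\<close> takes only the values
  0 and 1; a second-moment computation shows that the maximizers among the latter are exactly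
  the simplex measures, and this yields the threshold. For exponents \<open>p > 1\<close> simplex measures are
  moreover \<open>d_inf\<close>-local maximizers: spreading the mass within a cap around \<open>\<plusminus> v i\<close> gains energy of
  order \<open>p\<close> in the size of the cap, but destroys the orthogonality to the other caps at a cost of
  first order. If the threshold \<open>t\<close> exceeds 1 and the curve were continuous there, optimizers for
  exponents slightly below \<open>t\<close> would be close, via the optimizer at \<open>t\<close>, to simplex measures, which
  would then be optimal below the threshold.
\<close>

subsection \<open>The angular kernel\<close>

text \<open>A priori the optimizer at the threshold need not be a simplex measure, which is why both
  sides of \<open>t\<close> enter: only beyond \<open>t\<close> is every optimizer known to be one.
  The cap radius has to be fixed before the exponent below \<open>t\<close> is chosen. Hence local
  optimality is proved for one auxiliary exponent \<open>p\<close> strictly between 1 and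
  \<open>t\<close> and passed on to larger exponents: energies decrease in the exponent, while
  simplex measures keep the value \<open>1 / 2 * (1 - 1 / n)\<close> with
  \<open>n = CARD('n)\<close>. Room for such a \<open>p\<close> is what a threshold above 1
  provides. The strength of \<open>d_inf\<close> is that almost all mass moves a short way: each cap
  receives mass at least \<open>1 / n\<close>, and since \<open>n\<close> disjoint caps share total
  mass 1, each has exactly \<open>1 / n\<close> and no stray mass remains.\<close>

lemma inner_sphere_bounds:
  fixes x y :: "real ^ 'n"
  assumes "x \<in> sphere 0 1" "y \<in> sphere 0 1"
  shows "\<bar>x \<bullet> y\<bar> \<le> 1"
  using Cauchy_Schwarz_ineq2[of x y] assms by simp

lemma geo_dist_bounds:
  fixes x y :: "real ^ 'n"
  assumes "x \<in> sphere 0 1" "y \<in> sphere 0 1"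
  shows "0 \<le> geo_dist x y" "geo_dist x y \<le> pi"
  using inner_sphere_bounds[OF assms] unfolding geo_dist_def
  by (auto intro: arccos_lbound arccos_ubound)

lemma dist_sphere_eq_sin:
  fixes x y :: "real ^ 'n"
  assumes "x \<in> sphere 0 1" "y \<in> sphere 0 1"
  shows "norm (x - y) = 2 * sin (geo_dist x y / 2)"
proof -
  define \<rho> where "\<rho> = geo_dist x y"
  have c: "cos \<rho> = x \<bullet> y"
    using inner_sphere_bounds[OF assms] by (simp add: \<rho>_def geo_dist_def cos_arccos_abs)
  have "(norm (x - y))\<^sup>2 = 2 - 2 * (x \<bullet> y)"
    using assms by (simp add: power2_norm_eq_inner inner_diff inner_commute norm_eq_1)
  also have "\<dots> = (2 * sin (\<rho> / 2))\<^sup>2"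
    using cos_double_sin[of "\<rho> / 2"] c by (simp add: power_mult_distrib)
  finally have "(norm (x - y))\<^sup>2 = (2 * sin (\<rho> / 2))\<^sup>2" .
  moreover have "0 \<le> sin (\<rho> / 2)"
    using geo_dist_bounds[OF assms] by (intro sin_ge_zero) (auto simp: \<rho>_def)
  ultimately have "norm (x - y) = 2 * sin (\<rho> / 2)"
    by (auto intro!: power2_eq_imp_eq[of "norm (x - y)" "2 * sin (\<rho> / 2)"] simp del: power_mult_distrib)
  then show ?thesis by (simp add: \<rho>_def)
qed

lemma dist_sphere_le_geo_dist:
  fixes x y :: "real ^ 'n"
  assumes "x \<in> sphere 0 1" "y \<in> sphere 0 1"
  shows "norm (x - y) \<le> geo_dist x y"
  using dist_sphere_eq_sin[OF assms] sin_x_le_x[of "geo_dist x y / 2"] geo_dist_bounds[OF assms]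
  by simp

text \<open>The derivative of \<open>sin\<close> stays above \<open>cos (pi / 3) = 1 / 2\<close> on
  this interval.\<close>

lemma sin_ge_half:
  fixes x :: real
  assumes "0 \<le> x" "x \<le> pi / 4"
  shows "x / 2 \<le> sin x"
proof (cases "x = 0")
  case False
  then have "0 < x" using assms by simp
  have "\<exists>z. 0 < z \<and> z < x \<and> sin x - sin 0 = (x - 0) * cos z"
    by (rule MVT2[OF \<open>0 < x\<close>]) (auto intro: DERIV_sin)
  then obtain z where z: "0 < z" "z < x" "sin x = x * cos z" by auto
  have "1 / 2 = cos (pi / 3)" by (simp add: cos_60)
  also have "\<dots> \<le> cos z"
    using z assms by (intro cos_monotone_0_pi_le) auto
  finally show ?thesis using z(3) assms(1) mult_left_mono[of "1/2" "cos z" x] by simp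
qed simp

lemma Lam_nonneg:
  fixes x y :: "real ^ 'n"
  assumes "x \<in> sphere 0 1" "y \<in> sphere 0 1"
  shows "0 \<le> Lam x y"
  using geo_dist_bounds[OF assms] by (simp add: Lam_def)

lemma Lam_uminus_right:
  fixes x y :: "real ^ 'n"
  assumes "x \<in> sphere 0 1" "y \<in> sphere 0 1"
  shows "Lam x (- y) = Lam x y"
proof -
  have "geo_dist x (- y) = pi - geo_dist x y"
    using inner_sphere_bounds[OF assms] by (simp add: geo_dist_def arccos_minus_abs)
  then show ?thesis by (simp add: Lam_def min.commute)
qed

text \<open>If \<open>0 \<le> x \<bullet> z\<close> and \<rho> is the angle, then
  \<open>x \<bullet> z = sin (pi / 2 - \<rho>)\<close> is at most \<open>pi / 2 - \<rho>\<close>;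
  antipodal symmetry covers the other sign. The loss is linear in the deviation from orthogonality,
  and this is the first-order cost of leaving a simplex measure.\<close>

lemma Lam_le_one_minus_inner:
  fixes x y :: "real ^ 'n"
  assumes xy: "x \<in> sphere 0 1" "y \<in> sphere 0 1"
  shows "Lam x y \<le> 1 - 2 / pi * \<bar>x \<bullet> y\<bar>"
proof -
  have *: "Lam x z \<le> 1 - 2 / pi * (x \<bullet> z)" if "0 \<le> x \<bullet> z" "z \<in> sphere 0 1" for z
  proof -
    define \<rho> where "\<rho> = geo_dist x z"
    have c: "cos \<rho> = x \<bullet> z"
      using inner_sphere_bounds[OF xy(1) that(2)] by (simp add: \<rho>_def geo_dist_def cos_arccos_abs)
    have "\<rho> \<le> pi / 2"
      using that inner_sphere_bounds[OF xy(1) that(2)]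
      unfolding \<rho>_def geo_dist_def by (intro arccos_le_pi2) auto
    then have "x \<bullet> z \<le> pi / 2 - \<rho>"
      using sin_x_le_x[of "pi / 2 - \<rho>"] c by (simp add: sin_diff)
    then have "min \<rho> (pi - \<rho>) \<le> pi / 2 - (x \<bullet> z)" by simp
    then have "2 / pi * min \<rho> (pi - \<rho>) \<le> 2 / pi * (pi / 2 - (x \<bullet> z))"
      by (intro mult_left_mono) auto
    then show ?thesis by (simp add: Lam_def \<rho>_def algebra_simps)
  qed
  show ?thesis
  proof (cases "0 \<le> x \<bullet> y")
    case True then show ?thesis using *[of y] xy by simp
  next
    case False then show ?thesis using *[of "- y"] Lam_uminus_right[OF xy] xy by simp
  qed
qed

lemma Lam_le_one:
  fixes x y :: "real ^ 'n"
  assumes "x \<in> sphere 0 1" "y \<in> sphere 0 1"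
  shows "Lam x y \<le> 1"
proof -
  have "0 \<le> 2 / pi * \<bar>x \<bullet> y\<bar>" by simp
  then show ?thesis using Lam_le_one_minus_inner[OF assms] by linarith
qed

lemma Lam_le_dist:
  fixes x y :: "real ^ 'n"
  assumes xy: "x \<in> sphere 0 1" "y \<in> sphere 0 1"
  shows "Lam x y \<le> 2 * norm (x - y)"
proof -
  define \<rho> where "\<rho> = geo_dist x y"
  have \<rho>: "0 \<le> \<rho>" "\<rho> \<le> pi" using geo_dist_bounds[OF xy] by (auto simp: \<rho>_def)
  have d: "norm (x - y) = 2 * sin (\<rho> / 2)" by (simp add: \<rho>_def dist_sphere_eq_sin[OF xy])
  show ?thesis
  proof (cases "\<rho> \<le> pi / 2")
    case True
    have "\<rho> \<le> 2 * norm (x - y)" using sin_ge_half[of "\<rho> / 2"] True \<rho> d by simp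
    moreover have "Lam x y \<le> 2 / pi * \<rho>"
      by (simp add: Lam_def \<rho>_def divide_right_mono)
    moreover have "2 / pi * \<rho> \<le> 1 * \<rho>"
      using \<rho> pi_ge_two by (intro mult_right_mono) auto
    ultimately show ?thesis by simp
  next
    case False
    \<comment> \<open>Beyond a right angle the claimed bound is at least 2, so
      \<open>Lam \<le> 1\<close> suffices.\<close>
    have "1 / 2 = sin (pi / 6)" by (simp add: sin_30)
    also have "\<dots> \<le> sin (\<rho> / 2)"
      using False \<rho> pi_gt_zero by (intro sin_monotone_2pi_le) linarith+
    finally show ?thesis using d Lam_le_one[OF xy] by simp
  qed
qed

lemma Lam_le_dist_uminus:
  fixes x y :: "real ^ 'n"
  assumes "x \<in> sphere 0 1" "y \<in> sphere 0 1"
  shows "Lam x y \<le> 2 * norm (x + y)"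
  using Lam_le_dist[of x "- y"] Lam_uminus_right[OF assms] assms by simp

lemma Lam_eq_zero_iff:
  fixes x y :: "real ^ 'n"
  assumes xy: "x \<in> sphere 0 1" "y \<in> sphere 0 1"
  shows "Lam x y = 0 \<longleftrightarrow> \<bar>x \<bullet> y\<bar> = 1"
proof -
  define \<rho> where "\<rho> = geo_dist x y"
  have \<rho>: "0 \<le> \<rho>" "\<rho> \<le> pi" using geo_dist_bounds[OF xy] by (auto simp: \<rho>_def)
  have c: "cos \<rho> = x \<bullet> y"
    using inner_sphere_bounds[OF xy] by (simp add: \<rho>_def geo_dist_def cos_arccos_abs)
  have "Lam x y = 0 \<longleftrightarrow> \<rho> = 0 \<or> \<rho> = pi"
    using \<rho> by (auto simp: Lam_def \<rho>_def[symmetric] min_def)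
  also have "\<dots> \<longleftrightarrow> \<bar>x \<bullet> y\<bar> = 1"
  proof
    assume "\<rho> = 0 \<or> \<rho> = pi"
    then show "\<bar>x \<bullet> y\<bar> = 1" using c by auto
  next
    assume "\<bar>x \<bullet> y\<bar> = 1"
    then have "x \<bullet> y = 1 \<or> x \<bullet> y = -1" by linarith
    then show "\<rho> = 0 \<or> \<rho> = pi" by (auto simp: \<rho>_def geo_dist_def)
  qed
  finally show ?thesis .
qed

lemma Lam_eq_one_iff:
  fixes x y :: "real ^ 'n"
  assumes xy: "x \<in> sphere 0 1" "y \<in> sphere 0 1"
  shows "Lam x y = 1 \<longleftrightarrow> x \<bullet> y = 0"
proof
  assume "Lam x y = 1"
  then have "2 / pi * \<bar>x \<bullet> y\<bar> \<le> 0" using Lam_le_one_minus_inner[OF xy] by simp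
  then show "x \<bullet> y = 0" using pi_gt_zero by (simp add: divide_le_0_iff del: pi_gt_zero)
next
  assume "x \<bullet> y = 0"
  then show "Lam x y = 1" by (simp add: Lam_def geo_dist_def)
qed

lemma Lam_pow_bounds:
  fixes x y :: "real ^ 'n"
  assumes "x \<in> sphere 0 1" "y \<in> sphere 0 1" "0 < \<alpha>"
  shows "0 \<le> Lam_pow \<alpha> x y" "Lam_pow \<alpha> x y \<le> 1"
  using Lam_nonneg[OF assms(1,2)] Lam_le_one[OF assms(1,2)] assms(3)
  by (cases \<alpha>; auto simp: Lam_pow_def powr_le1)+

lemma Lam_pow_orthogonal:
  fixes x y :: "real ^ 'n"
  assumes "x \<bullet> y = 0"
  shows "Lam_pow \<alpha> x y = 1"
  using assms by (simp add: Lam_pow_def Lam_def geo_dist_def)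

text \<open>\<open>0 powr a\<close> is 0 for every real \<open>a\<close>, so finite and infinite
  exponents agree on parallel pairs.\<close>

lemma Lam_pow_parallel:
  fixes x y :: "real ^ 'n"
  assumes "x \<in> sphere 0 1" "y \<in> sphere 0 1" "\<bar>x \<bullet> y\<bar> = 1"
  shows "Lam_pow \<alpha> x y = 0"
  using assms Lam_eq_zero_iff[OF assms(1,2)] by (auto simp: Lam_pow_def)

lemma Lam_pow_strict_antimono:
  fixes x y :: "real ^ 'n"
  assumes xy: "x \<in> sphere 0 1" "y \<in> sphere 0 1" and ab: "0 < \<alpha>" "\<alpha> < \<beta>"
    and ne: "x \<bullet> y \<noteq> 0" "\<bar>x \<bullet> y\<bar> \<noteq> 1"
  shows "Lam_pow \<beta> x y < Lam_pow \<alpha> x y"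
proof -
  have L: "0 < Lam x y" "Lam x y < 1"
    using Lam_nonneg[OF xy] Lam_le_one[OF xy] Lam_eq_zero_iff[OF xy] Lam_eq_one_iff[OF xy] ne
    by auto
  obtain a where a: "\<alpha> = ereal a" "0 < a" using ab by (cases \<alpha>) auto
  show ?thesis
  proof (cases \<beta>)
    case (real b)
    then show ?thesis using L a ab by (simp add: Lam_pow_def powr_less_mono')
  qed (use L a ab ne in \<open>auto simp: Lam_pow_def\<close>)
qed

lemma Lam_pow_antimono:
  fixes x y :: "real ^ 'n"
  assumes "x \<in> sphere 0 1" "y \<in> sphere 0 1" "0 < \<alpha>" "\<alpha> \<le> \<beta>"
  shows "Lam_pow \<beta> x y \<le> Lam_pow \<alpha> x y"
proof (cases "\<alpha> = \<beta> \<or> x \<bullet> y = 0 \<or> \<bar>x \<bullet> y\<bar> = 1")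
  case True
  then show ?thesis using Lam_pow_orthogonal[of x y] Lam_pow_parallel[of x y] assms by auto
next
  case False
  then show ?thesis
    using Lam_pow_strict_antimono[of x y \<alpha> \<beta>] assms order_le_imp_less_or_eq[of \<alpha> \<beta>]
    by (auto intro: less_imp_le)
qed

subsection \<open>Energies and product measures\<close>

lemma space_sphere_borel [simp]: "space (sphere_borel :: (real ^ 'n) measure) = sphere 0 1"
  by (simp add: sphere_borel_def space_restrict_space)

lemma sphere_probsD:
  assumes "\<mu> \<in> sphere_probs"
  shows "prob_space \<mu>" "sets \<mu> = sets sphere_borel" "space \<mu> = sphere 0 1"
  using assms sets_eq_imp_space_eq[of \<mu> sphere_borel] by (auto simp: sphere_probs_def)

lemma sphere_borel_sets:
  fixes A :: "(real ^ 'n) set"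
  assumes "A \<in> sets borel"
  shows "A \<inter> sphere 0 1 \<in> sets sphere_borel"
  unfolding sphere_borel_def using assms by (auto simp: sets_restrict_space)

lemma id_measurable_sphere_borel: "(\<lambda>x. x) \<in> measurable (sphere_borel :: (real ^ 'n) measure) borel"
  unfolding sphere_borel_def by (rule measurable_restrict_space1) simp

text \<open>Lets Borel functions and open sets of the ambient product be used with the product
  sigma-algebra.\<close>

lemma measurable_pair_sphere_borel:
  "(\<lambda>z. z) \<in> measurable (sphere_borel \<Otimes>\<^sub>M sphere_borel :: ((real ^ 'n) \<times> (real ^ 'n)) measure) borel"
proof -
  let ?S = "sphere_borel :: (real ^ 'n) measure"
  have 1: "fst \<in> measurable (?S \<Otimes>\<^sub>M ?S) borel"
    using measurable_compose[OF measurable_fst[of ?S ?S] id_measurable_sphere_borel] by simp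
  have 2: "snd \<in> measurable (?S \<Otimes>\<^sub>M ?S) borel"
    using measurable_compose[OF measurable_snd[of ?S ?S] id_measurable_sphere_borel] by simp
  show ?thesis
    using borel_measurable_Pair[OF 1 2] by simp
qed

lemma borel_measurable_pair_sphere:
  assumes "\<mu> \<in> sphere_probs" "\<nu> \<in> sphere_probs"
    and "f \<in> borel_measurable borel"
  shows "f \<in> borel_measurable (\<mu> \<Otimes>\<^sub>M \<nu> :: ((real ^ 'n) \<times> (real ^ 'n)) measure)"
proof -
  have "f \<in> borel_measurable (sphere_borel \<Otimes>\<^sub>M sphere_borel)"
    using measurable_compose[OF measurable_pair_sphere_borel assms(3)] by simp
  moreover have "sets (\<mu> \<Otimes>\<^sub>M \<nu>) = sets (sphere_borel \<Otimes>\<^sub>M sphere_borel)"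
    using sphere_probsD(2)[OF assms(1)] sphere_probsD(2)[OF assms(2)] by (intro sets_pair_measure_cong)
  ultimately show ?thesis
    using measurable_cong_sets[OF _ refl] by blast
qed

text \<open>\<open>arccos\<close> is well behaved only on [-1, 1]; the clipped version is continuous
  on the whole line and agrees with it on inner products of unit vectors.\<close>

lemma borel_measurable_arccos_clip: "(\<lambda>t::real. arccos (max (- 1) (min 1 t))) \<in> borel_measurable borel"
  by (intro borel_measurable_continuous_onI continuous_on_compose2[OF continuous_on_arccos'])
    (auto intro!: continuous_intros)

lemma Lam_pow_borel_measurable:
  fixes \<mu> :: "(real ^ 'n) measure"
  assumes "\<mu> \<in> sphere_probs" "\<nu> \<in> sphere_probs"
  shows "(\<lambda>z. Lam_pow \<alpha> (fst z) (snd z)) \<in> borel_measurable (\<mu> \<Otimes>\<^sub>M \<nu>)"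
proof -
  define clip where "clip t = arccos (max (- 1) (min 1 t))" for t :: real
  have [measurable]: "clip \<in> borel_measurable borel"
    unfolding clip_def by (rule borel_measurable_arccos_clip)
  have "(\<lambda>z :: (real ^ 'n) \<times> (real ^ 'n). fst z \<bullet> snd z) \<in> borel_measurable borel"
    by (intro borel_measurable_continuous_onI continuous_intros)
  note [measurable] = borel_measurable_pair_sphere[OF assms this]
  define F where "F z = (if \<alpha> = \<infinity> then (if fst z \<bullet> snd z = 0 then 1 else 0)
     else (2 / pi * min (clip (fst z \<bullet> snd z)) (pi - clip (fst z \<bullet> snd z))) powr real_of_ereal \<alpha>)"
    for z :: "(real ^ 'n) \<times> (real ^ 'n)"
  have "F \<in> borel_measurable (\<mu> \<Otimes>\<^sub>M \<nu>)"
    unfolding F_def by (cases "\<alpha> = \<infinity>") simp_all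
  moreover have "Lam_pow \<alpha> (fst z) (snd z) = F z" if "z \<in> space (\<mu> \<Otimes>\<^sub>M \<nu>)" for z
  proof -
    have "fst z \<in> sphere 0 1" "snd z \<in> sphere 0 1"
      using that sphere_probsD(3)[OF assms(1)] sphere_probsD(3)[OF assms(2)]
      by (auto simp: space_pair_measure)
    from inner_sphere_bounds[OF this] have "clip (fst z \<bullet> snd z) = geo_dist (fst z) (snd z)"
      by (auto simp: clip_def geo_dist_def abs_le_iff min_def max_def intro: arg_cong[of _ _ arccos])
    then show ?thesis by (simp add: F_def Lam_pow_def Lam_def)
  qed
  ultimately show ?thesis by (simp cong: measurable_cong)
qed

lemma Lam_pow_integrable:
  fixes \<mu> :: "(real ^ 'n) measure"
  assumes "\<mu> \<in> sphere_probs" "0 < \<alpha>"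
  shows "integrable (\<mu> \<Otimes>\<^sub>M \<mu>) (\<lambda>z. Lam_pow \<alpha> (fst z) (snd z))"
proof -
  interpret prob_space \<mu> using sphere_probsD[OF assms(1)] by simp
  interpret P: pair_prob_space \<mu> \<mu> ..
  show ?thesis
  proof (rule P.integrable_const_bound[where B = 1])
    show "AE z in \<mu> \<Otimes>\<^sub>M \<mu>. norm (Lam_pow \<alpha> (fst z) (snd z)) \<le> 1"
    proof (rule AE_I2)
      fix z assume "z \<in> space (\<mu> \<Otimes>\<^sub>M \<mu>)"
      then have "fst z \<in> sphere 0 1" "snd z \<in> sphere 0 1"
        using sphere_probsD(3)[OF assms(1)] by (auto simp: space_pair_measure)
      from Lam_pow_bounds[OF this assms(2)] show "norm (Lam_pow \<alpha> (fst z) (snd z)) \<le> 1" by simp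
    qed
  qed (rule Lam_pow_borel_measurable[OF assms(1,1)])
qed

lemma energy_eq_pair:
  fixes \<mu> :: "(real ^ 'n) measure"
  assumes "\<mu> \<in> sphere_probs" "0 < \<alpha>"
  shows "energy \<alpha> \<mu> = 1 / 2 * (\<integral>z. Lam_pow \<alpha> (fst z) (snd z) \<partial>(\<mu> \<Otimes>\<^sub>M \<mu>))"
proof -
  interpret prob_space \<mu> using sphere_probsD[OF assms(1)] by simp
  interpret P: pair_prob_space \<mu> \<mu> ..
  show ?thesis
    using P.integral_fst'[OF Lam_pow_integrable[OF assms]] by (simp add: energy_def)
qed

lemma energy_antimono:
  fixes \<mu> :: "(real ^ 'n) measure"
  assumes "\<mu> \<in> sphere_probs" "0 < \<alpha>" "\<alpha> \<le> \<beta>"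
  shows "energy \<beta> \<mu> \<le> energy \<alpha> \<mu>"
proof -
  have "0 < \<beta>" using assms by auto
  have "(\<integral>z. Lam_pow \<beta> (fst z) (snd z) \<partial>(\<mu> \<Otimes>\<^sub>M \<mu>)) \<le> (\<integral>z. Lam_pow \<alpha> (fst z) (snd z) \<partial>(\<mu> \<Otimes>\<^sub>M \<mu>))"
    using Lam_pow_antimono[OF _ _ assms(2,3)] sphere_probsD(3)[OF assms(1)]
    by (intro integral_mono Lam_pow_integrable assms \<open>0 < \<beta>\<close>) (auto simp: space_pair_measure)
  then show ?thesis
    using energy_eq_pair[OF assms(1,2)] energy_eq_pair[OF assms(1) \<open>0 < \<beta>\<close>] by simp
qed

section \<open>Block kernels of a family of disjoint cells\<close>

lemma (in prob_space) integral_pair_mult: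
  fixes f g :: "'a \<Rightarrow> real"
  assumes "integrable M f" "integrable M g"
  shows "integrable (M \<Otimes>\<^sub>M M) (\<lambda>z. f (fst z) * g (snd z))"
    and "(\<integral>z. f (fst z) * g (snd z) \<partial>(M \<Otimes>\<^sub>M M)) = (\<integral>x. f x \<partial>M) * (\<integral>x. g x \<partial>M)"
proof -
  interpret P: pair_prob_space M M ..
  have [measurable]: "f \<in> borel_measurable M" "g \<in> borel_measurable M" using assms by auto
  show i: "integrable (M \<Otimes>\<^sub>M M) (\<lambda>z. f (fst z) * g (snd z))"
    using assms by (intro P.Fubini_integrable) (auto simp: abs_mult)
  show "(\<integral>z. f (fst z) * g (snd z) \<partial>(M \<Otimes>\<^sub>M M)) = (\<integral>x. f x \<partial>M) * (\<integral>x. g x \<partial>M)"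
    using P.integral_fst'[OF i] by simp
qed

text \<open>The model kernel of a simplex measure: no interaction inside a cell, interaction 1
  between cells. As a sum of products it integrates factor by factor. A pair with a point outside
  all cells also gets the value 1.\<close>

definition cell_sep :: "('i::finite \<Rightarrow> 'a set) \<Rightarrow> 'a \<Rightarrow> 'a \<Rightarrow> real" where
  "cell_sep D x y = 1 - (\<Sum>i\<in>UNIV. indicator (D i) x * indicator (D i) y)"

lemma cell_sep_eq:
  assumes "disjoint_family D" "x \<in> D i" "y \<in> D j"
  shows "cell_sep D x y = (if i = j then 0 else 1)"
proof -
  have x: "indicator (D k) x = (if k = i then 1 else 0 :: real)"
    and y: "indicator (D k) y = (if k = j then 1 else 0 :: real)" for k
    using assms by (auto simp: disjoint_family_on_def indicator_def)
  have "(\<Sum>k\<in>UNIV. indicator (D k) x * indicator (D k) y) = (\<Sum>k\<in>UNIV. if k = i then (if i = j then 1 else 0) else 0 :: real)"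
    unfolding x y by (intro sum.cong) auto
  then show ?thesis unfolding cell_sep_def by simp
qed

lemma cell_sep_cases:
  assumes "disjoint_family D"
  shows "cell_sep D x y = 0 \<or> cell_sep D x y = 1"
proof (cases "(\<exists>i. x \<in> D i) \<and> (\<exists>j. y \<in> D j)")
  case True
  then show ?thesis using cell_sep_eq[OF assms] by metis
next
  case False
  then have "indicator (D i) x * indicator (D i) y = (0 :: real)" for i by auto
  then show ?thesis by (simp only: cell_sep_def sum.neutral_const) simp
qed

lemma (in prob_space) integral_cell_sep:
  fixes D :: "'i::finite \<Rightarrow> 'a set"
  assumes [measurable]: "\<And>i. D i \<in> events"
  shows "integrable (M \<Otimes>\<^sub>M M) (\<lambda>z. cell_sep D (fst z) (snd z))"
    and "(\<integral>z. cell_sep D (fst z) (snd z) \<partial>(M \<Otimes>\<^sub>M M)) = 1 - (\<Sum>i\<in>UNIV. (prob (D i))\<^sup>2)"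
proof -
  interpret P: pair_prob_space M M ..
  define h :: "'i \<Rightarrow> 'a \<times> 'a \<Rightarrow> real" where "h i z = indicator (D i) (fst z) * indicator (D i) (snd z)" for i z
  have ind: "integrable M (indicator (D i) :: 'a \<Rightarrow> real)" for i
    by (simp add: emeasure_eq_measure)
  have i: "integrable (M \<Otimes>\<^sub>M M) (h i)" for i
    unfolding h_def by (intro integral_pair_mult ind)
  have e: "(\<integral>z. h i z \<partial>(M \<Otimes>\<^sub>M M)) = (prob (D i))\<^sup>2" for i
    unfolding h_def using integral_pair_mult(2)[OF ind ind, of i i] by (simp add: power2_eq_square)
  have c: "cell_sep D (fst z) (snd z) = 1 - (\<Sum>i\<in>UNIV. h i z)" for z
    by (simp only: cell_sep_def h_def)
  show "integrable (M \<Otimes>\<^sub>M M) (\<lambda>z. cell_sep D (fst z) (snd z))"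
    unfolding c using i by simp
  show "(\<integral>z. cell_sep D (fst z) (snd z) \<partial>(M \<Otimes>\<^sub>M M)) = 1 - (\<Sum>i\<in>UNIV. (prob (D i))\<^sup>2)"
    unfolding c using i e by (simp add: P.prob_space)
qed

text \<open>The masses are at least \<open>1 / n\<close> each and sum to at most 1, so there is
  equality throughout and the complement of the cells is null.\<close>

lemma (in prob_space) equal_cells:
  fixes D :: "'i::finite \<Rightarrow> 'a set"
  assumes D: "\<And>i. D i \<in> events" "disjoint_family D"
    and ge: "\<And>i. 1 / real CARD('i) \<le> prob (D i)"
  shows "prob (D i) = 1 / real CARD('i)" and "AE x in M. x \<in> (\<Union>i. D i)"
proof -
  have s: "prob (\<Union>i. D i) = (\<Sum>i\<in>UNIV. prob (D i))"
    using D by (intro finite_measure_finite_Union) (auto simp: disjoint_family_on_def)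
  have "1 = (\<Sum>i\<in>(UNIV::'i set). 1 / real CARD('i))" by simp
  also have le: "\<dots> \<le> (\<Sum>i\<in>UNIV. prob (D i))" by (intro sum_mono ge)
  finally have "1 \<le> (\<Sum>i\<in>UNIV. prob (D i))" .
  then have eq: "(\<Sum>i\<in>UNIV. prob (D i)) = 1" using prob_le_1[of "\<Union>i. D i"] s by linarith
  then have "(\<Sum>i\<in>UNIV. prob (D i) - 1 / real CARD('i)) = 0"
    by (simp add: sum_subtractf)
  then have "prob (D i) - 1 / real CARD('i) = 0"
    using ge by (subst (asm) sum_nonneg_eq_0_iff) auto
  then show "prob (D i) = 1 / real CARD('i)" by simp
  show "AE x in M. x \<in> (\<Union>i. D i)"
    using eq s D by (intro AE_prob_1) simp
qed

section \<open>Orthonormal bases and the energy of simplex measures\<close>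

lemma orthonormal_basisD:
  assumes "orthonormal_basis v"
  shows "v i \<bullet> v j = (if i = j then 1 else 0)" "norm (v i) = 1" "v i \<in> sphere 0 1"
  using assms by (auto simp: orthonormal_basis_def norm_eq_1)

lemma orthonormal_basis_axis: "orthonormal_basis (\<lambda>i. axis i 1 :: real ^ 'n)"
proof -
  have "(Basis :: (real ^ 'n) set) = range (\<lambda>i. axis i 1)"
    by (auto simp: Basis_vec_def)
  then show ?thesis
    unfolding orthonormal_basis_def using span_Basis by (auto simp: inner_axis_axis)
qed

lemma orthonormal_imp_basis:
  fixes v :: "'n::finite \<Rightarrow> real ^ 'n"
  assumes o: "\<And>i j. v i \<bullet> v j = (if i = j then 1 else 0)"
  shows "orthonormal_basis v"
proof -
  have inj: "inj v"
    using o by (intro injI) (metis zero_neq_one)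
  have "independent (range v)"
    using o by (intro pairwise_orthogonal_independent)
      (auto simp: pairwise_def orthogonal_def split: if_splits, metis inner_zero_left zero_neq_one)
  moreover have "card (range v) = dim (UNIV :: (real ^ 'n) set)"
    by (simp add: card_image inj)
  ultimately have "span (range v) = UNIV"
    using card_ge_dim_independent[of "range v" UNIV] by auto
  then show ?thesis using o by (simp add: orthonormal_basis_def)
qed

text \<open>The remainder \<open>u\<close> is orthogonal to the basis, hence to its span, hence to
  itself.\<close>

lemma orthonormal_basis_expansion:
  assumes "orthonormal_basis v"
  shows "w = (\<Sum>i\<in>UNIV. (w \<bullet> v i) *\<^sub>R v i)"
proof -
  define u where "u = w - (\<Sum>i\<in>UNIV. (w \<bullet> v i) *\<^sub>R v i)"
  have "orthogonal u x" if "x \<in> range v" for x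
    using that
    by (auto simp: orthogonal_def u_def inner_diff_left inner_sum_left orthonormal_basisD(1)[OF assms]
        if_distrib[of "times _"] cong: if_cong)
  then have "orthogonal u u"
    using assms by (intro orthogonal_to_span[of u "range v"]) (auto simp: orthonormal_basis_def)
  then show ?thesis by (simp add: orthogonal_def u_def)
qed

text \<open>Quantifies that no vector is almost orthogonal to all basis vectors; the energy loss
  near a simplex measure rests on it.\<close>

lemma norm_le_sum_inner_basis:
  assumes "orthonormal_basis v"
  shows "norm w \<le> (\<Sum>i\<in>UNIV. \<bar>w \<bullet> v i\<bar>)"
proof -
  have "norm w \<le> (\<Sum>i\<in>UNIV. norm ((w \<bullet> v i) *\<^sub>R v i))"
    by (subst orthonormal_basis_expansion[OF assms, of w]) (rule norm_sum)
  then show ?thesis using orthonormal_basisD(2)[OF assms] by simp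
qed

lemma finite_in_sphere_borel:
  fixes A :: "(real ^ 'n) set"
  assumes "finite A" "A \<subseteq> sphere 0 1"
  shows "A \<in> sets sphere_borel"
proof -
  have "A \<in> sets borel" using assms by (intro borel_closed finite_imp_closed)
  from sphere_borel_sets[OF this] show ?thesis using assms by (simp add: Int_absorb2)
qed

text \<open>Almost every pair of points is orthogonal or parallel, where the kernel is 1 or 0 at
  every exponent. So the kernel coincides with \<open>cell_sep\<close>, and neither the exponent nor
  the division of mass between \<open>v i\<close> and \<open>- v i\<close> affects the
  value.\<close>

lemma energy_simplex:
  fixes \<mu> :: "(real ^ 'n) measure"
  assumes "\<mu> \<in> simplex_probs" "0 < \<alpha>"
  shows "energy \<alpha> \<mu> = 1 / 2 * (1 - 1 / real CARD('n))"
proof -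
  have \<mu>: "\<mu> \<in> sphere_probs" using assms by (simp add: simplex_probs_def)
  obtain v where v: "orthonormal_basis v" and m: "\<And>i. measure \<mu> {v i, - v i} = 1 / real CARD('n)"
    using assms by (auto simp: simplex_probs_def)
  interpret prob_space \<mu> using sphere_probsD[OF \<mu>] by simp
  interpret P: pair_prob_space \<mu> \<mu> ..
  note vD = orthonormal_basisD[OF v]
  define D where "D i = {v i, - v i}" for i
  have D[measurable]: "D i \<in> events" for i
    using finite_in_sphere_borel[of "D i"] vD(3) sphere_probsD(2)[OF \<mu>] by (simp add: D_def)
  have dis: "disjoint_family D"
  proof -
    have "v i \<noteq> v j" "v i \<noteq> - v j" if "i \<noteq> j" for i j
      using vD(1)[of i j] vD(1)[of j j] that by auto
    then show ?thesis by (fastforce simp: disjoint_family_on_def D_def)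
  qed
  have "AE x in \<mu>. x \<in> (\<Union>i. D i)"
    using m by (intro equal_cells(2) D dis) (simp add: D_def)
  then have ae: "AE z in \<mu> \<Otimes>\<^sub>M \<mu>. fst z \<in> (\<Union>i. D i) \<and> snd z \<in> (\<Union>i. D i)"
    by (intro P.AE_pair_measure) (auto simp: pred_def[symmetric])
  have [measurable]: "(\<lambda>z. cell_sep D (fst z) (snd z)) \<in> borel_measurable (\<mu> \<Otimes>\<^sub>M \<mu>)"
    by (intro borel_measurable_integrable integral_cell_sep(1) D)
  have "(\<integral>z. Lam_pow \<alpha> (fst z) (snd z) \<partial>(\<mu> \<Otimes>\<^sub>M \<mu>)) = (\<integral>z. cell_sep D (fst z) (snd z) \<partial>(\<mu> \<Otimes>\<^sub>M \<mu>))"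
  proof (intro integral_cong_AE)
    show "AE z in \<mu> \<Otimes>\<^sub>M \<mu>. Lam_pow \<alpha> (fst z) (snd z) = cell_sep D (fst z) (snd z)"
      using ae
    proof eventually_elim
      case (elim z)
      then obtain i j where ij: "fst z \<in> D i" "snd z \<in> D j" by auto
      have "Lam_pow \<alpha> (fst z) (snd z) = (if i = j then 0 else 1)"
      proof (cases "i = j")
        case True
        then have "\<bar>fst z \<bullet> snd z\<bar> = 1" using ij vD(1)[of i j] by (auto simp: D_def)
        then show ?thesis
          using Lam_pow_parallel[of "fst z" "snd z" \<alpha>] ij vD(3) True by (auto simp: D_def)
      next
        case False
        then have "fst z \<bullet> snd z = 0" using ij vD(1)[of i j] by (auto simp: D_def)
        then show ?thesis using Lam_pow_orthogonal[of "fst z" "snd z"] False by simp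
      qed
      then show ?case using cell_sep_eq[OF dis ij] by simp
    qed
  qed (use Lam_pow_borel_measurable[OF \<mu> \<mu>] integral_cell_sep(1)[OF D] in auto)
  also have "\<dots> = 1 - (\<Sum>i\<in>(UNIV :: 'n set). (1 / real CARD('n))\<^sup>2)"
    using integral_cell_sep(2)[of D] D m by (simp add: D_def)
  also have "\<dots> = 1 - 1 / real CARD('n)" by (simp add: power2_eq_square)
  finally show ?thesis using energy_eq_pair[OF \<mu> assms(2)] by simp
qed

section \<open>Uniform measures on finite families and exponents below 1\<close>

text \<open>Indexed by a family rather than a set, so that a repeated point carries multiple
  mass.\<close>

definition points_measure :: "('k::finite \<Rightarrow> real ^ 'n) \<Rightarrow> (real ^ 'n) measure" where
  "points_measure p = distr (measure_pmf (pmf_of_set UNIV)) sphere_borel p"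

lemma points_measure_sphere_probs:
  fixes p :: "'k::finite \<Rightarrow> real ^ 'n"
  assumes "range p \<subseteq> sphere 0 1"
  shows "points_measure p \<in> sphere_probs"
proof -
  have "p \<in> measurable (measure_pmf (pmf_of_set UNIV)) sphere_borel"
    using assms by auto
  then show ?thesis
    by (simp add: sphere_probs_def points_measure_def measure_pmf.prob_space_distr)
qed

lemma integral_points_measure:
  fixes p :: "'k::finite \<Rightarrow> real ^ 'n" and f :: "real ^ 'n \<Rightarrow> real"
  assumes "range p \<subseteq> sphere 0 1" "f \<in> borel_measurable sphere_borel"
  shows "(\<integral>x. f x \<partial>points_measure p) = (\<Sum>k\<in>UNIV. f (p k)) / real CARD('k)"
proof -
  have "p \<in> measurable (measure_pmf (pmf_of_set UNIV)) sphere_borel"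
    using assms by auto
  then show ?thesis
    unfolding points_measure_def using assms(2)
    by (simp add: integral_distr integral_pmf_of_set)
qed

lemma energy_points_measure:
  fixes p :: "'k::finite \<Rightarrow> real ^ 'n"
  assumes p: "range p \<subseteq> sphere 0 1" and "0 < \<alpha>"
  shows "energy \<alpha> (points_measure p)
    = 1 / 2 * ((\<Sum>k\<in>UNIV. \<Sum>l\<in>UNIV. Lam_pow \<alpha> (p k) (p l)) / (real CARD('k))\<^sup>2)"
proof -
  define \<mu> where "\<mu> = points_measure p"
  have \<mu>: "\<mu> \<in> sphere_probs" unfolding \<mu>_def by (rule points_measure_sphere_probs[OF p])
  interpret prob_space \<mu> using sphere_probsD[OF \<mu>] by simp
  interpret P: pair_prob_space \<mu> \<mu> ..
  have cong: "borel_measurable \<mu> = (borel_measurable sphere_borel :: (real ^ 'n \<Rightarrow> real) set)"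
    using sphere_probsD(2)[OF \<mu>] by (rule measurable_cong_sets) simp
  have m: "(\<lambda>z. Lam_pow \<alpha> (fst z) (snd z)) \<in> borel_measurable (\<mu> \<Otimes>\<^sub>M \<mu>)"
    by (rule Lam_pow_borel_measurable[OF \<mu> \<mu>])
  have 1: "(\<lambda>y. Lam_pow \<alpha> (p k) y) \<in> borel_measurable sphere_borel" for k
  proof -
    have "p k \<in> space \<mu>" using p unfolding sphere_probsD(3)[OF \<mu>] by blast
    from measurable_compose[OF measurable_Pair1'[OF this] m] show ?thesis by (simp add: cong)
  qed
  have 2: "(\<lambda>x. \<integral>y. Lam_pow \<alpha> x y \<partial>\<mu>) \<in> borel_measurable sphere_borel"
    using borel_measurable_lebesgue_integral[of "Lam_pow \<alpha>" \<mu>] m by (simp add: split_beta' cong)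
  show ?thesis
    unfolding energy_def \<mu>_def[symmetric]
    using integral_points_measure[OF p 2] integral_points_measure[OF p 1]
    by (simp add: \<mu>_def[symmetric] sum_divide_distrib power2_eq_square)
qed

lemma simplex_points_measure:
  fixes v :: "'n::finite \<Rightarrow> real ^ 'n"
  assumes "orthonormal_basis v"
  shows "points_measure v \<in> simplex_probs"
proof -
  note vD = orthonormal_basisD[OF assms]
  have r: "range v \<subseteq> sphere 0 1" using vD by auto
  have "measure (points_measure v) {v i, - v i} = 1 / real CARD('n)" for i
  proof -
    have "v j = v i \<longleftrightarrow> j = i" "v j \<noteq> - v i" for j
      using vD(1)[of i j] vD(1)[of i i] vD(1)[of j j] inner_minus_right[of "v i" "v i"]
      by (metis zero_neq_one, metis neg_equal_iff_equal neg_0_equal_iff_equal zero_neq_one one_neq_neg_one)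
    then have "v -` {v i, - v i} = {i}" by auto
    moreover have "v \<in> measurable (measure_pmf (pmf_of_set UNIV)) sphere_borel" using r by auto
    moreover have "{v i, - v i} \<in> sets sphere_borel" using vD(3) by (intro finite_in_sphere_borel) auto
    ultimately show ?thesis
      by (simp add: points_measure_def measure_distr measure_pmf_of_set)
  qed
  then show ?thesis
    using assms points_measure_sphere_probs[OF r] by (auto simp: simplex_probs_def)
qed

lemma simplex_probs_nonempty: "(simplex_probs :: (real ^ 'n) measure set) \<noteq> {}"
  using simplex_points_measure[OF orthonormal_basis_axis] by blast

text \<open>The angle is \<open>pi / 4\<close> or \<open>3 * pi / 4\<close>, halfway between
  parallel and orthogonal.\<close>

lemma Lam_pow_diagonal:
  fixes x y :: "real ^ 'n"
  assumes "\<bar>x \<bullet> y\<bar> = sqrt 2 / 2"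
  shows "Lam_pow (ereal a) x y = (1 / 2) powr a"
proof -
  have a: "arccos (sqrt 2 / 2) = pi / 4"
    by (rule arccos_unique) (auto simp: cos_45)
  have b: "arccos (- (sqrt 2 / 2)) = 3 * pi / 4"
    using arccos_minus_abs[of "sqrt 2 / 2"] a sqrt2_less_2 by simp
  have "x \<bullet> y = sqrt 2 / 2 \<or> x \<bullet> y = - (sqrt 2 / 2)" using assms by linarith
  then have "geo_dist x y = pi / 4 \<or> geo_dist x y = 3 * pi / 4"
    unfolding geo_dist_def using a b by metis
  then have "min (geo_dist x y) (pi - geo_dist x y) = pi / 4"
    using pi_gt_zero by linarith
  then have "Lam x y = 1 / 2"
    by (simp add: Lam_def)
  then have "Lam x y powr a = (1 / 2) powr a" by (rule arg_cong)
  then show ?thesis by (simp add: Lam_pow_def)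
qed

text \<open>Half of the mass on two axes is turned by 45 degrees inside their plane.\<close>

lemma simplex_not_argmax:
  assumes n: "2 \<le> CARD('n::finite)" and \<alpha>: "0 < \<alpha>" "\<alpha> < 1"
  shows "(simplex_probs :: (real ^ 'n) measure set) \<inter> energy_argmax \<alpha> = {}"
proof (rule ccontr)
  assume "\<not> ?thesis"
  then obtain \<mu> :: "(real ^ 'n) measure" where \<mu>: "\<mu> \<in> simplex_probs" "\<mu> \<in> energy_argmax \<alpha>"
    by auto
  obtain a where a: "\<alpha> = ereal a" "0 < a" "a < 1" using \<alpha> by (cases \<alpha>) (auto simp: one_ereal_def)
  obtain i0 i1 :: 'n where ne: "i0 \<noteq> i1"
    using n card_2_iff'[of "UNIV :: 'n set"] card_le_Suc0_iff_eq[of "UNIV :: 'n set"] by fastforce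
  obtain v :: "'n \<Rightarrow> real ^ 'n" where v: "orthonormal_basis v" using orthonormal_basis_axis by blast
  note vI = orthonormal_basisD(1)[OF v]
  define s where "s = sqrt 2 / 2"
  have ss: "s * s = 1 / 2" by (simp add: s_def)
  define e0 where "e0 = s *\<^sub>R v i0 + s *\<^sub>R v i1"
  define e1 where "e1 = s *\<^sub>R v i0 - s *\<^sub>R v i1"
  have e: "e0 \<bullet> e0 = 1" "e1 \<bullet> e1 = 1" "e0 \<bullet> e1 = 0" "e1 \<bullet> e0 = 0"
    using ne ss by (auto simp: e0_def e1_def inner_add inner_diff vI)
  have ev: "e0 \<bullet> v j = (if j = i0 \<or> j = i1 then s else 0)"
    "e1 \<bullet> v j = (if j = i0 then s else if j = i1 then - s else 0)" for j
    using ne by (auto simp: e0_def e1_def inner_add inner_diff vI)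
  have ve: "v j \<bullet> e0 = (if j = i0 \<or> j = i1 then s else 0)"
    "v j \<bullet> e1 = (if j = i0 then s else if j = i1 then - s else 0)" for j
    using ev by (simp_all add: inner_commute)
  \<comment> \<open>The Boolean marks the half of the mass that may be turned; axes outside the
    plane occur twice with the same vector.\<close>
  define p where "p k = (if snd k \<and> fst k = i0 then e0 else if snd k \<and> fst k = i1 then e1 else v (fst k))" for k
  have p: "range p \<subseteq> sphere 0 1"
    using e by (auto simp: p_def norm_eq_1 vI)
  define h where "h = (1 / 2 :: real) powr a"
  have h: "1 / 2 < h"
    using powr_less_mono'[of "1 / 2" a 1] a by (simp add: h_def)
  \<comment> \<open>The change caused by the turn: between a turned and an unturned vector of the
    plane the kernel is \<open>h\<close> instead of \<open>of_bool (i \<noteq> j)\<close>.\<close>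
  define A where "A i j = of_bool (i \<in> {i0, i1} \<and> j \<in> {i0, i1}) * (h - of_bool (i \<noteq> j))" for i j
  have val: "Lam_pow \<alpha> (p (i, b)) (p (j, c)) = of_bool (i \<noteq> j) + A i j * of_bool (b \<noteq> c)" for i j b c
  proof -
    define t where "t = \<bar>p (i, b) \<bullet> p (j, c)\<bar>"
    have t: "t = (if i \<in> {i0, i1} \<and> j \<in> {i0, i1} \<and> b \<noteq> c then s else of_bool (i = j))"
    proof -
      have "\<bar>s\<bar> = s" by (simp add: s_def)
      then show ?thesis
        using ne unfolding t_def p_def fst_conv snd_conv
        by (cases b; cases c; simp add: e ev ve vI)
    qed
    have sph: "p (i, b) \<in> sphere 0 1" "p (j, c) \<in> sphere 0 1" using p by blast+
    consider "i \<in> {i0, i1} \<and> j \<in> {i0, i1} \<and> b \<noteq> c" | "\<not> (i \<in> {i0, i1} \<and> j \<in> {i0, i1} \<and> b \<noteq> c)" "i = j"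
      | "\<not> (i \<in> {i0, i1} \<and> j \<in> {i0, i1} \<and> b \<noteq> c)" "i \<noteq> j" by blast
    then show ?thesis
    proof cases
      case 1
      then have "Lam_pow \<alpha> (p (i, b)) (p (j, c)) = h"
        using t unfolding t_def a(1) h_def s_def by (intro Lam_pow_diagonal) simp
      then show ?thesis using 1 by (auto simp: A_def)
    next
      case 2
      then have "t = 1" using t by auto
      then have "Lam_pow \<alpha> (p (i, b)) (p (j, c)) = 0"
        using Lam_pow_parallel[OF sph] by (simp add: t_def)
      then show ?thesis using 2 by (auto simp: A_def)
    next
      case 3
      then have "t = 0" using t by auto
      then have "Lam_pow \<alpha> (p (i, b)) (p (j, c)) = 1"
        by (intro Lam_pow_orthogonal) (simp add: t_def)
      then show ?thesis using 3 by (auto simp: A_def)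
    qed
  qed
  have pairs: "(\<Sum>k\<in>UNIV. f k) = (\<Sum>i\<in>UNIV. \<Sum>b\<in>UNIV. f (i, b))" for f :: "'n \<times> bool \<Rightarrow> real"
    by (simp add: sum.cartesian_product UNIV_Times_UNIV[symmetric] split_beta' del: UNIV_Times_UNIV)
  let ?n = "real CARD('n)"
  \<comment> \<open>Two diagonal pairs contribute \<open>h\<close> and two others
    \<open>h - 1\<close>. The sum is positive because \<open>1 / 2 < h\<close>, which is where the
    exponent below 1 enters.\<close>
  have A: "(\<Sum>i\<in>UNIV. \<Sum>j\<in>UNIV. A i j) = 4 * h - 2"
  proof -
    have "(\<Sum>i\<in>UNIV. \<Sum>j\<in>UNIV. A i j) = (\<Sum>i\<in>{i0, i1}. \<Sum>j\<in>{i0, i1}. A i j)"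
    proof (rule sum.mono_neutral_cong_right)
      show "(\<Sum>j\<in>UNIV. A i j) = (\<Sum>j\<in>{i0, i1}. A i j)" if "i \<in> {i0, i1}" for i
        by (rule sum.mono_neutral_right) (auto simp: A_def)
    qed (auto simp: A_def)
    then show ?thesis using ne by (simp add: A_def)
  qed
  have N: "(\<Sum>i\<in>(UNIV :: 'n set). \<Sum>j\<in>UNIV. of_bool (i \<noteq> j)) = ?n * (?n - 1)"
  proof -
    have "{j. i \<noteq> j} = UNIV - {i}" for i :: 'n by auto
    then have "(\<Sum>j\<in>UNIV. of_bool (i \<noteq> j)) = ?n - 1" for i :: 'n
      using n by (simp add: of_nat_diff)
    then show ?thesis by simp
  qed
  have "(\<Sum>k\<in>UNIV. \<Sum>l\<in>UNIV. Lam_pow \<alpha> (p k) (p l))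
      = (\<Sum>i\<in>UNIV. \<Sum>j\<in>UNIV. 4 * of_bool (i \<noteq> j) + 2 * A i j)"
  proof -
    have "(\<Sum>k\<in>UNIV. \<Sum>l\<in>UNIV. Lam_pow \<alpha> (p k) (p l))
      = (\<Sum>i\<in>UNIV. \<Sum>b\<in>(UNIV :: bool set). \<Sum>j\<in>UNIV. \<Sum>c\<in>UNIV. of_bool (i \<noteq> j) + A i j * of_bool (b \<noteq> c))"
      by (simp only: pairs val)
    \<comment> \<open>Of the four pairs of Booleans, two consist of different values.\<close>
    also have "\<dots> = (\<Sum>i\<in>UNIV. \<Sum>j\<in>UNIV. 4 * of_bool (i \<noteq> j) + 2 * A i j)"
      by (intro sum.cong refl) (simp add: UNIV_bool sum.distrib[symmetric] algebra_simps)
    finally show ?thesis .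
  qed
  also have "\<dots> = 4 * (?n * (?n - 1)) + 2 * (4 * h - 2)"
    unfolding sum.distrib sum_distrib_left[symmetric] A N ..
  also have "\<dots> > 4 * (?n * (?n - 1))" using h by simp
  finally have "4 * (?n * (?n - 1)) < (\<Sum>k\<in>UNIV. \<Sum>l\<in>UNIV. Lam_pow \<alpha> (p k) (p l))" .
  then have "4 * (?n * (?n - 1)) / (2 * ?n)\<^sup>2 < (\<Sum>k\<in>UNIV. \<Sum>l\<in>UNIV. Lam_pow \<alpha> (p k) (p l)) / (2 * ?n)\<^sup>2"
    using n by (intro divide_strict_right_mono) auto
  moreover have "4 * (?n * (?n - 1)) / (2 * ?n)\<^sup>2 = 1 - 1 / ?n"
    using n by (simp add: field_simps power2_eq_square)
  ultimately have "energy \<alpha> \<mu> < energy \<alpha> (points_measure p)"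
    unfolding energy_simplex[OF \<mu>(1) \<alpha>(1)] energy_points_measure[OF p \<alpha>(1)] by simp
  then show False
    using \<mu>(2) points_measure_sphere_probs[OF p] by (fastforce simp: energy_argmax_def)
qed

lemma sphere_probs_measurable:
  fixes \<mu> :: "(real ^ 'n) measure"
  assumes "\<mu> \<in> sphere_probs" "f \<in> borel_measurable borel"
  shows "f \<in> borel_measurable \<mu>"
proof -
  have "f \<in> borel_measurable sphere_borel"
    using measurable_compose[OF id_measurable_sphere_borel assms(2)] by simp
  then show ?thesis using measurable_cong_sets[OF sphere_probsD(2)[OF assms(1)] refl] by blast
qed

subsection \<open>Maximizers beyond a simplex-optimal exponent\<close>

text \<open>Let \<open>a\<close> be the second-moment matrix. Its trace is 1 because the measure
  lives on the unit sphere, and by Fubini its squared Frobenius norm is the double integral,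
  \<open>1 / n\<close>. Hence its squared distance to the identity divided by \<open>n\<close> is
  \<open>1 / n - 2 / n + 1 / n = 0\<close>.\<close>

lemma second_moment_isotropic:
  fixes \<mu> :: "(real ^ 'n) measure"
  assumes \<mu>: "\<mu> \<in> sphere_probs"
    and eq: "(\<integral>z. (fst z \<bullet> snd z)\<^sup>2 \<partial>(\<mu> \<Otimes>\<^sub>M \<mu>)) = 1 / real CARD('n)"
  shows "(\<integral>x. (v \<bullet> x)\<^sup>2 \<partial>\<mu>) = (v \<bullet> v) / real CARD('n)"
proof -
  interpret prob_space \<mu> using sphere_probsD[OF \<mu>] by simp
  interpret P: pair_prob_space \<mu> \<mu> ..
  let ?n = "real CARD('n)"
  define f where "f i j x = x $ i * x $ j" for i j and x :: "real ^ 'n"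
  define a where "a i j = (\<integral>x. f i j x \<partial>\<mu>)" for i j
  have [measurable]: "f i j \<in> borel_measurable \<mu>" for i j
    unfolding f_def by (intro sphere_probs_measurable[OF \<mu>] borel_measurable_continuous_onI continuous_intros)
  have b: "\<bar>f i j x\<bar> \<le> 1" if "x \<in> space \<mu>" for i j x
  proof -
    have "norm x = 1" using that sphere_probsD(3)[OF \<mu>] by simp
    then have "\<bar>x $ i\<bar> * \<bar>x $ j\<bar> \<le> 1 * 1"
      using component_le_norm_cart[of x i] component_le_norm_cart[of x j] by (intro mult_mono) auto
    then show ?thesis by (simp add: f_def abs_mult)
  qed
  have fi: "integrable \<mu> (f i j)" for i j
    using b by (intro integrable_const_bound[where B = 1]) auto
  have gi: "integrable (\<mu> \<Otimes>\<^sub>M \<mu>) (\<lambda>z. f i j (fst z) * f i j (snd z))" for i j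
    by (intro integral_pair_mult fi)
  have g: "(\<integral>z. f i j (fst z) * f i j (snd z) \<partial>(\<mu> \<Otimes>\<^sub>M \<mu>)) = (a i j)\<^sup>2" for i j
    unfolding a_def power2_eq_square by (intro integral_pair_mult fi)
  have sq: "(x \<bullet> y)\<^sup>2 = (\<Sum>i\<in>UNIV. \<Sum>j\<in>UNIV. f i j x * f i j y)" for x y
    by (simp add: f_def inner_vec_def power2_eq_square sum_product algebra_simps)
  have frob: "(\<Sum>i\<in>UNIV. \<Sum>j\<in>UNIV. (a i j)\<^sup>2) = 1 / ?n"
    using eq gi unfolding sq by (simp add: g)
  have tr: "(\<Sum>i\<in>UNIV. a i i) = 1"
  proof -
    have "(\<Sum>i\<in>UNIV. a i i) = (\<integral>x. (\<Sum>i\<in>UNIV. f i i x) \<partial>\<mu>)" using fi by (simp add: a_def)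
    also have "\<dots> = (\<integral>x. 1 \<partial>\<mu>)"
    proof (rule Bochner_Integration.integral_cong[OF refl])
      fix x assume "x \<in> space \<mu>"
      then have "x \<bullet> x = 1" using sphere_probsD(3)[OF \<mu>] by (simp add: norm_eq_1)
      then show "(\<Sum>i\<in>UNIV. f i i x) = 1" by (simp add: f_def inner_vec_def)
    qed
    finally show ?thesis by (simp add: prob_space)
  qed
  define \<delta> where "\<delta> i j = (if i = j then 1 / ?n else 0)" for i j :: 'n
  have "(\<Sum>i\<in>UNIV. \<Sum>j\<in>UNIV. (a i j - \<delta> i j)\<^sup>2)
      = (\<Sum>i\<in>UNIV. \<Sum>j\<in>UNIV. (a i j)\<^sup>2) - 2 * (\<Sum>i\<in>UNIV. \<Sum>j\<in>UNIV. a i j * \<delta> i j)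
        + (\<Sum>i\<in>UNIV. \<Sum>j\<in>UNIV. (\<delta> i j)\<^sup>2)"
    by (simp add: power2_diff sum.distrib sum_subtractf sum_distrib_left mult.assoc)
  also have "(\<Sum>i\<in>UNIV. \<Sum>j\<in>UNIV. a i j * \<delta> i j) = 1 / ?n"
    using tr by (simp add: \<delta>_def if_distrib sum_divide_distrib[symmetric] cong: if_cong)
  also have "(\<Sum>i\<in>UNIV. \<Sum>j\<in>UNIV. (\<delta> i j)\<^sup>2) = 1 / ?n"
  proof -
    have "(\<Sum>j\<in>UNIV. (\<delta> i j)\<^sup>2) = (1 / ?n)\<^sup>2" for i
      by (simp add: \<delta>_def if_distrib[of "\<lambda>x. x\<^sup>2"] cong: if_cong)
    then show ?thesis by (simp add: power2_eq_square)
  qed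
  finally have "(\<Sum>i\<in>UNIV. \<Sum>j\<in>UNIV. (a i j - \<delta> i j)\<^sup>2) = 0" using frob by simp
  then have a: "a i j = \<delta> i j" for i j
    by (simp add: sum_nonneg_eq_0_iff sum_nonneg)
  have "(v \<bullet> x)\<^sup>2 = (\<Sum>i\<in>UNIV. \<Sum>j\<in>UNIV. v $ i * v $ j * f i j x)" for x
    unfolding sq by (simp add: f_def)
  then have "(\<integral>x. (v \<bullet> x)\<^sup>2 \<partial>\<mu>) = (\<Sum>i\<in>UNIV. \<Sum>j\<in>UNIV. v $ i * v $ j * a i j)"
    using fi by (simp add: a_def)
  also have "\<dots> = (v \<bullet> v) / ?n"
    by (simp add: a \<delta>_def if_distrib inner_vec_def sum_divide_distrib cong: if_cong)
  finally show ?thesis .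
qed

lemma sphere_inner_eq_one_iff:
  fixes x y :: "real ^ 'n"
  assumes "x \<in> sphere 0 1" "y \<in> sphere 0 1"
  shows "\<bar>x \<bullet> y\<bar> = 1 \<longleftrightarrow> y \<in> {x, - x}"
proof
  assume "\<bar>x \<bullet> y\<bar> = 1"
  then have "x \<bullet> y = 1 \<or> x \<bullet> y = - 1" by linarith
  then have "(x - y) \<bullet> (x - y) = 0 \<or> (x + y) \<bullet> (x + y) = 0"
    using assms by (auto simp: inner_add inner_diff inner_commute norm_eq_1)
  then show "y \<in> {x, - x}" by (auto simp: eq_neg_iff_add_eq_0 add.commute)
qed (use assms in \<open>auto simp: norm_eq_1\<close>)

lemma (in prob_space) AE_imp_ex_in_set:
  assumes "AE x in M. P x" "A \<in> events" "0 < prob A"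
  shows "\<exists>x\<in>A. P x"
proof (rule ccontr)
  assume "\<not> ?thesis"
  then have "AE x in M. x \<notin> A" using assms(1) by (auto elim: eventually_mono)
  then have "prob A = 0" using assms(2) by (simp add: prob_eq_0)
  then show False using assms(3) by simp
qed

text \<open>For a typical point \<open>x\<close> the function \<open>(x \<bullet> y)\<^sup>2\<close>
  of \<open>y\<close> is almost everywhere the indicator of \<open>{x, - x}\<close>, so isotropy
  gives this pair mass \<open>1 / n\<close>. Typical points on different lines are orthogonal, and
  \<open>n\<close> such lines are picked greedily.\<close>

lemma simplex_if_orthogonal_or_parallel:
  fixes \<mu> :: "(real ^ 'n) measure"
  assumes \<mu>: "\<mu> \<in> sphere_probs"
    and ae: "AE x in \<mu>. AE y in \<mu>. x \<bullet> y = 0 \<or> \<bar>x \<bullet> y\<bar> = 1"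
    and mom: "\<And>v. (\<integral>x. (v \<bullet> x)\<^sup>2 \<partial>\<mu>) = (v \<bullet> v) / real CARD('n)"
  shows "\<mu> \<in> simplex_probs"
proof -
  interpret prob_space \<mu> using sphere_probsD[OF \<mu>] by simp
  let ?n = "real CARD('n)"
  define G where "G = {x \<in> sphere 0 1. AE y in \<mu>. x \<bullet> y = 0 \<or> \<bar>x \<bullet> y\<bar> = 1}"
  have pm[measurable]: "{x, - x} \<in> events" if "x \<in> G" for x
    using that finite_in_sphere_borel[of "{x, - x}"] sphere_probsD(2)[OF \<mu>] by (auto simp: G_def)
  have mass: "prob {x, - x} = 1 / ?n" if "x \<in> G" for x
  proof -
    have "(\<integral>y. (x \<bullet> y)\<^sup>2 \<partial>\<mu>) = (\<integral>y. indicator {x, - x} y \<partial>\<mu>)"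
    proof (rule integral_cong_AE)
      have "AE y in \<mu>. x \<bullet> y = 0 \<or> \<bar>x \<bullet> y\<bar> = 1" using that by (simp add: G_def)
      then show "AE y in \<mu>. (x \<bullet> y)\<^sup>2 = indicator {x, - x} y"
        using AE_space
      proof eventually_elim
        case (elim y)
        have "x \<in> sphere 0 1" "y \<in> sphere 0 1" using that elim sphere_probsD(3)[OF \<mu>] by (auto simp: G_def)
        from sphere_inner_eq_one_iff[OF this] elim(1) show ?case
          by (cases "x \<bullet> y = 0") (auto simp: indicator_def power2_eq_1_iff abs_if split: if_splits)
      qed
      show "(\<lambda>y. (x \<bullet> y)\<^sup>2) \<in> borel_measurable \<mu>"
        by (intro sphere_probs_measurable[OF \<mu>] borel_measurable_continuous_onI continuous_intros)
    qed (use pm[OF that] in auto)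
    moreover have "x \<bullet> x = 1" using that by (simp add: G_def norm_eq_1)
    ultimately show ?thesis using mom[of x] pm[OF that] by simp
  qed
  have orth: "x \<bullet> y = 0" if "x \<in> G" "y \<in> G" "y \<notin> {x, - x}" for x y
  proof -
    \<comment> \<open>The pair \<open>{y, - y}\<close> has positive mass, so the almost-sure
      property of \<open>x\<close> holds at one of its points, and by symmetry at
      \<open>y\<close>.\<close>
    have "AE z in \<mu>. x \<bullet> z = 0 \<or> \<bar>x \<bullet> z\<bar> = 1" using that by (simp add: G_def)
    then have "\<exists>z\<in>{y, - y}. x \<bullet> z = 0 \<or> \<bar>x \<bullet> z\<bar> = 1"
      by (rule AE_imp_ex_in_set) (use that pm mass in auto)
    then have "x \<bullet> y = 0 \<or> \<bar>x \<bullet> y\<bar> = 1" by auto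
    then show ?thesis using sphere_inner_eq_one_iff[of x y] that by (auto simp: G_def)
  qed
  have frame: "\<exists>X. finite X \<and> X \<subseteq> G \<and> card X = k \<and> (\<forall>x\<in>X. \<forall>y\<in>X. x \<noteq> y \<longrightarrow> x \<bullet> y = 0)" if "k \<le> CARD('n)" for k
    using that
  proof (induction k)
    case 0
    then show ?case by (intro exI[of _ "{}"]) auto
  next
    case (Suc k)
    then obtain X where X: "finite X" "X \<subseteq> G" "card X = k" "\<forall>x\<in>X. \<forall>y\<in>X. x \<noteq> y \<longrightarrow> x \<bullet> y = 0" by auto
    define U where "U = (\<Union>x\<in>X. {x, - x})"
    have U: "U \<in> events" unfolding U_def using X pm by (intro sets.finite_UN) auto
    \<comment> \<open>Fewer than \<open>n\<close> lines carry mass below 1, so a typical point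
      remains off them.\<close>
    have "prob U \<le> (\<Sum>x\<in>X. prob {x, - x})"
      unfolding U_def using X pm by (intro finite_measure_subadditive_finite) auto
    also have "\<dots> = k / ?n" using X mass by (simp add: subset_iff)
    also have "\<dots> < 1" using Suc.prems by (simp add: divide_less_eq)
    finally have "0 < prob (space \<mu> - U)" using U by (simp add: prob_compl)
    moreover have "AE x in \<mu>. x \<in> G"
      using ae AE_space by eventually_elim (use sphere_probsD(3)[OF \<mu>] in \<open>auto simp: G_def\<close>)
    ultimately obtain y where y: "y \<in> G" "y \<notin> U"
      using AE_imp_ex_in_set[of "\<lambda>x. x \<in> G" "space \<mu> - U"] U by auto
    have o: "x \<bullet> y = 0" if "x \<in> X" for x
      by (rule orth) (use that X y in \<open>auto simp: U_def\<close>)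
    have "y \<notin> X" using y by (auto simp: U_def)
    show ?case
    proof (intro exI[of _ "insert y X"] conjI ballI impI)
      show "card (insert y X) = Suc k" using X \<open>y \<notin> X\<close> by simp
      fix a b assume "a \<in> insert y X" "b \<in> insert y X" "a \<noteq> b"
      then consider "a = y" "b \<in> X" | "b = y" "a \<in> X" | "a \<in> X" "b \<in> X" by blast
      then show "a \<bullet> b = 0"
        by cases (use o X(4) \<open>a \<noteq> b\<close> in \<open>simp_all add: inner_commute\<close>)
    qed (use X y in auto)
  qed
  obtain X where X: "finite X" "X \<subseteq> G" "card X = CARD('n)" "\<forall>x\<in>X. \<forall>y\<in>X. x \<noteq> y \<longrightarrow> x \<bullet> y = 0"
    using frame[OF order_refl] by blast
  then obtain v :: "'n \<Rightarrow> real ^ 'n" where v: "bij_betw v UNIV X"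
    using finite_same_card_bij[of "UNIV :: 'n set" X] by auto
  then have vX: "v i \<in> X" "v i = v j \<longleftrightarrow> i = j" for i j
    by (auto simp: bij_betw_def inj_def)
  have "v i \<bullet> v j = (if i = j then 1 else 0)" for i j
    using vX X by (auto simp: G_def norm_eq_1 subset_iff)
  then have "orthonormal_basis v" by (rule orthonormal_imp_basis)
  moreover have "measure \<mu> {v i, - v i} = 1 / ?n" for i
    using mass vX(1)[of i] X(2) by blast
  ultimately show ?thesis using \<mu> by (auto simp: simplex_probs_def)
qed

text \<open>All simplex measures have the same energy at all positive exponents, so the optimality
  of one of them at \<alpha> is a bound for every measure, which persists at \<beta>. A maximizer at
  \<beta> must attain it at both exponents.\<close>

lemma simplex_argmax_mono:
  fixes \<mu> :: "(real ^ 'n) measure"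
  assumes \<mu>: "\<mu> \<in> simplex_probs" "\<mu> \<in> energy_argmax \<alpha>" and \<alpha>: "0 < \<alpha>" "\<alpha> < \<beta>"
  shows "(simplex_probs :: (real ^ 'n) measure set) = energy_argmax \<beta>"
proof -
  let ?e = "1 / 2 * (1 - 1 / real CARD('n))"
  have \<beta>: "0 < \<beta>" using \<alpha> by auto
  have s\<mu>: "\<mu> \<in> sphere_probs" using \<mu> by (simp add: simplex_probs_def)
  have ub\<alpha>: "energy \<alpha> \<nu> \<le> ?e" if "\<nu> \<in> sphere_probs" for \<nu> :: "(real ^ 'n) measure"
    using \<mu>(2) that energy_simplex[OF \<mu>(1) \<alpha>(1)] by (simp add: energy_argmax_def)
  have ub: "energy \<beta> \<nu> \<le> ?e" if "\<nu> \<in> sphere_probs" for \<nu> :: "(real ^ 'n) measure"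
    using ub\<alpha>[OF that] energy_antimono[OF that \<alpha>(1) less_imp_le[OF \<alpha>(2)]] by simp
  show ?thesis
  proof (intro equalityI subsetI)
    fix \<nu> :: "(real ^ 'n) measure"
    assume "\<nu> \<in> simplex_probs"
    then have "\<nu> \<in> sphere_probs" "energy \<beta> \<nu> = ?e"
      using energy_simplex[OF _ \<beta>] by (auto simp: simplex_probs_def)
    then show "\<nu> \<in> energy_argmax \<beta>" using ub by (simp only: energy_argmax_def mem_Collect_eq) blast
  next
    fix \<nu> :: "(real ^ 'n) measure"
    assume \<nu>: "\<nu> \<in> energy_argmax \<beta>"
    then have s: "\<nu> \<in> sphere_probs" by (simp add: energy_argmax_def)
    interpret prob_space \<nu> using sphere_probsD[OF s] by simp
    interpret P: pair_prob_space \<nu> \<nu> ..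
    note [measurable] = Lam_pow_borel_measurable[OF s s]
    let ?L = "\<lambda>\<gamma> z. Lam_pow \<gamma> (fst z) (snd z)"
    have "energy \<beta> \<mu> \<le> energy \<beta> \<nu>" using \<nu> s\<mu> by (simp add: energy_argmax_def)
    then have "?e \<le> energy \<beta> \<nu>" using energy_simplex[OF \<mu>(1) \<beta>] by simp
    then have e: "energy \<beta> \<nu> = ?e" "energy \<alpha> \<nu> = ?e"
      using ub[OF s] ub\<alpha>[OF s] energy_antimono[OF s \<alpha>(1) less_imp_le[OF \<alpha>(2)]] by auto
    have sph: "fst z \<in> sphere 0 1" "snd z \<in> sphere 0 1" if "z \<in> space (\<nu> \<Otimes>\<^sub>M \<nu>)" for z
      using that sphere_probsD(3)[OF s] by (auto simp: space_pair_measure)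
    \<comment> \<open>Ordered kernels with equal integrals agree almost everywhere; strict
      monotonicity then leaves only orthogonal and parallel pairs.\<close>
    have "(\<integral>z. ?L \<alpha> z - ?L \<beta> z \<partial>(\<nu> \<Otimes>\<^sub>M \<nu>)) = 0"
      using e energy_eq_pair[OF s \<alpha>(1)] energy_eq_pair[OF s \<beta>]
        Lam_pow_integrable[OF s \<alpha>(1)] Lam_pow_integrable[OF s \<beta>] by simp
    moreover have "AE z in \<nu> \<Otimes>\<^sub>M \<nu>. 0 \<le> ?L \<alpha> z - ?L \<beta> z"
      using Lam_pow_antimono[OF sph \<alpha>(1)] \<alpha>(2) by (intro AE_I2) simp
    ultimately have "AE z in \<nu> \<Otimes>\<^sub>M \<nu>. ?L \<alpha> z - ?L \<beta> z = 0"
      using integral_nonneg_eq_0_iff_AE[of "\<nu> \<Otimes>\<^sub>M \<nu>" "\<lambda>z. ?L \<alpha> z - ?L \<beta> z"]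
        Lam_pow_integrable[OF s \<alpha>(1)] Lam_pow_integrable[OF s \<beta>] by simp
    then have ae: "AE z in \<nu> \<Otimes>\<^sub>M \<nu>. fst z \<bullet> snd z = 0 \<or> \<bar>fst z \<bullet> snd z\<bar> = 1"
      using AE_space by eventually_elim (use Lam_pow_strict_antimono[OF sph \<alpha>] in fastforce)
    have "(\<lambda>z :: (real ^ 'n) \<times> (real ^ 'n). fst z \<bullet> snd z) \<in> borel_measurable borel"
      by (intro borel_measurable_continuous_onI continuous_intros)
    note [measurable] = borel_measurable_pair_sphere[OF s s this]
    \<comment> \<open>On orthogonal and parallel pairs the squared inner product complements the
      kernel, so the energy value becomes the moment condition \<open>1 / n\<close>.\<close>
    have "(\<integral>z. (fst z \<bullet> snd z)\<^sup>2 \<partial>(\<nu> \<Otimes>\<^sub>M \<nu>)) = (\<integral>z. 1 - ?L \<beta> z \<partial>(\<nu> \<Otimes>\<^sub>M \<nu>))"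
    proof (rule integral_cong_AE)
      show "AE z in \<nu> \<Otimes>\<^sub>M \<nu>. (fst z \<bullet> snd z)\<^sup>2 = 1 - ?L \<beta> z"
        using ae AE_space
      proof eventually_elim
        case (elim z)
        from elim(1) show ?case
        proof
          assume "\<bar>fst z \<bullet> snd z\<bar> = 1"
          then show ?thesis
            using Lam_pow_parallel[OF sph[OF elim(2)]] by (simp add: power2_eq_1_iff abs_eq_iff')
        qed (simp add: Lam_pow_orthogonal)
      qed
    qed simp_all
    also have "\<dots> = 1 / real CARD('n)"
      using e energy_eq_pair[OF s \<beta>] Lam_pow_integrable[OF s \<beta>] by (simp add: P.prob_space)
    finally have "(\<integral>z. (fst z \<bullet> snd z)\<^sup>2 \<partial>(\<nu> \<Otimes>\<^sub>M \<nu>)) = 1 / real CARD('n)" .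
    from second_moment_isotropic[OF s this] show "\<nu> \<in> simplex_probs"
      using P.AE_pair[OF ae] by (intro simplex_if_orthogonal_or_parallel[OF s]) simp_all
  qed
qed

subsection \<open>Local optimality of simplex measures\<close>

text \<open>Both poles are included because the kernel does not see antipodes and a simplex measure
  prescribes only the mass of \<open>{v i, - v i}\<close>.\<close>

definition double_cap :: "real ^ 'n \<Rightarrow> real \<Rightarrow> (real ^ 'n) set" where
  "double_cap u r = {x \<in> sphere 0 1. norm (x - u) < r \<or> norm (x + u) < r}"

lemma double_cap_in_sphere_borel: "double_cap u r \<in> sets sphere_borel"
proof -
  have "ball u r \<union> ball (- u) r \<in> sets borel" by auto
  moreover have "double_cap u r = (ball u r \<union> ball (- u) r) \<inter> sphere 0 1"
    by (auto simp: double_cap_def dist_norm norm_minus_commute add.commute)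
  ultimately show ?thesis using sphere_borel_sets by metis
qed

text \<open>Cauchy-Schwarz against the nearer pole; the absolute values hide which pole that
  is.\<close>

lemma double_cap_inner_diff:
  assumes "x \<in> double_cap u r"
  shows "\<bar>\<bar>w \<bullet> x\<bar> - \<bar>w \<bullet> u\<bar>\<bar> \<le> r * norm w"
proof -
  have "\<bar>w \<bullet> x - w \<bullet> u\<bar> \<le> norm w * norm (x - u)" "\<bar>w \<bullet> x + w \<bullet> u\<bar> \<le> norm w * norm (x + u)"
    using Cauchy_Schwarz_ineq2[of w "x - u"] Cauchy_Schwarz_ineq2[of w "x + u"]
    by (simp_all add: inner_diff_right inner_add_right)
  moreover have "norm w * norm (x - u) \<le> norm w * r \<or> norm w * norm (x + u) \<le> norm w * r"
    using assms by (auto simp: double_cap_def intro: mult_left_mono)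
  ultimately show ?thesis by (auto simp: mult.commute)
qed

lemma disjoint_double_caps:
  assumes v: "orthonormal_basis v" and "r < 1 / 2"
  shows "disjoint_family (\<lambda>i. double_cap (v i) r)"
proof -
  have False if "i \<noteq> j" "x \<in> double_cap (v i) r" "x \<in> double_cap (v j) r" for i j x
  proof -
    \<comment> \<open>Tested against \<open>v j\<close>, a common point would have inner product at
      most \<open>r\<close> and at least \<open>1 - r\<close>.\<close>
    show False
      using double_cap_inner_diff[OF that(2), of "v j"] double_cap_inner_diff[OF that(3), of "v j"]
        orthonormal_basisD(1,2)[OF v, of j] that(1) assms(2) by simp
  qed
  then show ?thesis by (auto simp: disjoint_family_on_def)
qed

text \<open>Unit vectors satisfy \<open>(x - y) \<bullet> (x + y) = 0\<close>, so
  \<open>(x - y) \<bullet> u\<close> only sees how far the midpoint of \<open>x\<close> and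
  \<open>y\<close> is from \<open>u\<close>.\<close>

lemma chord_almost_tangent:
  fixes x y u :: "'a::real_inner"
  assumes "norm x = 1" "norm y = 1" "norm (x - u) < r" "norm (y - u) < r"
  shows "\<bar>(x - y) \<bullet> u\<bar> \<le> r * norm (x - y)" "norm (x - y) \<le> 2 * r"
proof -
  have "2 * ((x - y) \<bullet> u) = - ((x - y) \<bullet> ((x - u) + (y - u)))"
    using assms(1,2) by (simp add: norm_eq_1 inner_diff inner_add inner_commute algebra_simps)
  moreover have "\<bar>(x - y) \<bullet> ((x - u) + (y - u))\<bar> \<le> norm (x - y) * norm ((x - u) + (y - u))"
    by (rule Cauchy_Schwarz_ineq2)
  moreover have "norm ((x - u) + (y - u)) \<le> 2 * r"
    using norm_triangle_ineq[of "x - u" "y - u"] assms by simp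
  then have "norm (x - y) * norm ((x - u) + (y - u)) \<le> norm (x - y) * (2 * r)"
    by (rule mult_left_mono) simp
  ultimately show "\<bar>(x - y) \<bullet> u\<bar> \<le> r * norm (x - y)" by (simp add: algebra_simps)
  show "norm (x - y) \<le> 2 * r"
    using norm_triangle_ineq4[of "x - u" "y - u"] assms by simp
qed

text \<open>If \<open>x\<close> and \<open>y\<close> are near opposite poles, \<open>y\<close> is
  replaced by \<open>- y\<close>; this explains the two forms of \<open>w\<close>.\<close>

lemma double_cap_chord:
  assumes "x \<in> double_cap u r" "y \<in> double_cap u r"
  obtains w where "w = x - y \<or> w = x + y" "\<bar>w \<bullet> u\<bar> \<le> r * norm w" "norm w \<le> 2 * r"
proof -
  have n: "norm x = 1" "norm y = 1" using assms by (auto simp: double_cap_def)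
  have *: "norm (- y - u) = norm (y + u)" "norm (- y + u) = norm (y - u)"
    using norm_minus_cancel[of "y + u"] norm_minus_commute[of y u] by simp_all
  consider "norm (x - u) < r" "norm (y - u) < r" | "norm (x - u) < r" "norm (y + u) < r"
    | "norm (x + u) < r" "norm (y - u) < r" | "norm (x + u) < r" "norm (y + u) < r"
    using assms by (auto simp: double_cap_def)
  then show ?thesis
  proof cases
    case 1
    then show ?thesis using chord_almost_tangent[of x y u r] n by (intro that[of "x - y"]) auto
  next
    case 2
    then show ?thesis using chord_almost_tangent[of x "- y" u r] n * by (intro that[of "x + y"]) auto
  next
    case 3
    then show ?thesis
      using chord_almost_tangent[of x "- y" "- u" r] n * by (intro that[of "x + y"]) auto
  next
    case 4
    then show ?thesis
      using chord_almost_tangent[of x y "- u" r] n by (intro that[of "x - y"]) auto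
  qed
qed

text \<open>One factor of \<open>L powr p\<close> stays linear in the chord; the other
  \<open>p - 1\<close> powers go into a coefficient that tends to 0 with \<open>r\<close> because
  \<open>1 < p\<close>.\<close>

lemma Lam_pow_le_chord:
  fixes x y :: "real ^ 'n"
  assumes xy: "x \<in> sphere 0 1" "y \<in> sphere 0 1" and w: "w = x - y \<or> w = x + y" "norm w \<le> 2 * r"
    and p: "1 < p"
  shows "Lam_pow (ereal p) x y \<le> 2 * (4 * r) powr (p - 1) * norm w"
proof -
  define L where "L = Lam x y"
  have L: "0 \<le> L" "L \<le> 2 * norm w"
    using Lam_nonneg[OF xy] Lam_le_dist[OF xy] Lam_le_dist_uminus[OF xy] w by (auto simp: L_def)
  have "Lam_pow (ereal p) x y = L powr p" by (simp add: Lam_pow_def L_def)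
  also have "\<dots> = L powr (p - 1) * L"
    using powr_mult_base[OF L(1), of "p - 1"] by (simp add: mult.commute)
  also have "\<dots> \<le> (4 * r) powr (p - 1) * (2 * norm w)"
    using L w(2) p by (intro mult_mono powr_mono2) auto
  finally show ?thesis by (simp add: mult.commute mult.left_commute)
qed

text \<open>Two directions \<open>x\<close>, \<open>y\<close> in the cap of \<open>v i\<close> differ by an almost tangential vector \<open>w\<close>, so
  \<open>w\<close> has inner products of total size about \<open>norm w\<close> with samples from the other caps. Hence
  one of \<open>x\<close>, \<open>y\<close> is not orthogonal to those samples, and the energy lost in this way is of first
  order in \<open>norm w\<close>, whereas the energy gained inside the cap is of order \<open>p > 1\<close>.\<close>

lemma energy_near_simplex_le:
  fixes \<mu> :: "(real ^ 'n) measure"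
  assumes \<mu>: "\<mu> \<in> sphere_probs" and v: "orthonormal_basis v"
    and ge: "\<And>i. 1 / real CARD('n) \<le> measure \<mu> (double_cap (v i) r)"
    and r: "0 < r" "real CARD('n) * r < 1 / 2"
    and p: "1 < p" "2 * (4 * r) powr (p - 1) \<le> 1 / (2 * pi)"
  shows "energy (ereal p) \<mu> \<le> 1 / 2 * (1 - 1 / real CARD('n))"
proof -
  interpret prob_space \<mu> using sphere_probsD[OF \<mu>] by simp
  interpret P: pair_prob_space \<mu> \<mu> ..
  let ?n = "real CARD('n)"
  define c where "c = 2 * (4 * r) powr (p - 1)"
  have c: "0 \<le> c" "c \<le> 1 / (2 * pi)" using p by (auto simp: c_def)
  define D where "D i = double_cap (v i) r" for i
  have "1 * r \<le> ?n * r" using r by (intro mult_right_mono) auto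
  then have dis: "disjoint_family D"
    unfolding D_def using r by (intro disjoint_double_caps v) linarith
  have D[measurable]: "D i \<in> events" for i
    unfolding D_def using double_cap_in_sphere_borel sphere_probsD(2)[OF \<mu>] by simp
  have geD: "1 / ?n \<le> prob (D i)" for i using ge by (simp add: D_def)
  have mass: "prob (D i) = 1 / ?n" for i
    by (rule equal_cells(1)[OF D dis geD])
  have ae: "AE x in \<mu>. x \<in> (\<Union>i. D i)"
    by (rule equal_cells(2)[OF D dis geD])
  then have ae2: "AE z in \<mu> \<Otimes>\<^sub>M \<mu>. fst z \<in> (\<Union>i. D i) \<and> snd z \<in> (\<Union>i. D i)"
    by (intro P.AE_pair_measure) (auto simp: pred_def[symmetric])
  have DS: "x \<in> sphere 0 1" if "x \<in> D i" for x i using that by (simp add: D_def double_cap_def)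
  have ind: "integrable \<mu> (indicator (D i) :: _ \<Rightarrow> real)" for i by (simp add: emeasure_eq_measure)

  \<comment> \<open>Up to the factor \<open>2 / pi\<close>, \<open>G\<close> is the guaranteed loss
    of a pair in different caps, and \<open>g x\<close> is the mean loss of the pairs containing
    \<open>x\<close>.\<close>
  define G where "G z = cell_sep D (fst z) (snd z) * \<bar>fst z \<bullet> snd z\<bar>" for z
  define g where "g x = (\<integral>y. G (x, y) \<partial>\<mu>)" for x
  have "(\<lambda>z :: (real ^ 'n) \<times> (real ^ 'n). fst z \<bullet> snd z) \<in> borel_measurable borel"
    by (intro borel_measurable_continuous_onI continuous_intros)
  note [measurable] = borel_measurable_pair_sphere[OF \<mu> \<mu> this]
  have cs: "integrable (\<mu> \<Otimes>\<^sub>M \<mu>) (\<lambda>z. cell_sep D (fst z) (snd z))"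
    by (intro integral_cell_sep(1) D)
  then have [measurable]: "(\<lambda>z. cell_sep D (fst z) (snd z)) \<in> borel_measurable (\<mu> \<Otimes>\<^sub>M \<mu>)" by simp
  have G[measurable]: "G \<in> borel_measurable (\<mu> \<Otimes>\<^sub>M \<mu>)" unfolding G_def by measurable
  have G01: "0 \<le> G z" "G z \<le> 1" if "z \<in> space (\<mu> \<Otimes>\<^sub>M \<mu>)" for z
  proof -
    have "fst z \<in> sphere 0 1" "snd z \<in> sphere 0 1"
      using that sphere_probsD(3)[OF \<mu>] by (auto simp: space_pair_measure)
    from inner_sphere_bounds[OF this] show "0 \<le> G z" "G z \<le> 1"
      using cell_sep_cases[OF dis, of "fst z" "snd z"] by (auto simp: G_def)
  qed
  have Gi: "integrable (\<mu> \<Otimes>\<^sub>M \<mu>) G"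
    using G01 by (intro P.integrable_const_bound[where B = 1] AE_I2) auto
  have gi: "integrable \<mu> g" unfolding g_def by (rule P.integrable_fst'[OF Gi])
  have gG: "(\<integral>z. G z \<partial>(\<mu> \<Otimes>\<^sub>M \<mu>)) = (\<integral>x. g x \<partial>\<mu>)" unfolding g_def by (rule P.integral_fst'[OF Gi, symmetric])
  have g0: "0 \<le> (\<integral>x. g x \<partial>\<mu>)"
    unfolding gG[symmetric] using G01 by (intro integral_nonneg_AE AE_I2) auto

  have key: "Lam_pow (ereal p) x y \<le> 2 * ?n * c * (g x + g y)" if x: "x \<in> D i" and y: "y \<in> D i" for x y i
  proof -
    obtain w where w: "w = x - y \<or> w = x + y" "\<bar>w \<bullet> v i\<bar> \<le> r * norm w" "norm w \<le> 2 * r"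
      using x y double_cap_chord unfolding D_def by metis
    \<comment> \<open>\<open>a k\<close> bounds \<open>\<bar>w \<bullet> z\<bar>\<close> from below
      on the cap of \<open>v k\<close>; it may be negative.\<close>
    define a where "a k = \<bar>w \<bullet> v k\<bar> - r * norm w" for k
    define \<phi> where "\<phi> z = (\<Sum>k\<in>UNIV - {i}. a k * indicator (D k) z)" for z
    have sec: "integrable \<mu> (\<lambda>z. G (x, z))" if "x \<in> D i" for x
      using that DS sphere_probsD(3)[OF \<mu>] G01[of "(x, z)" for z] measurable_compose[OF measurable_Pair1' G]
      by (intro integrable_const_bound[where B = 1] AE_I2) (auto simp: space_pair_measure)
    have "norm w / 2 \<le> norm w - ?n * r * norm w"
      using mult_right_mono[OF less_imp_le[OF r(2)], of "norm w"] by simp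
    \<comment> \<open>The term \<open>a i\<close> is at most 0 because \<open>w\<close> is almost
      tangential at \<open>v i\<close>, so leaving it out does not lower the sum.\<close>
    also have "\<dots> \<le> (\<Sum>k\<in>UNIV - {i}. a k)"
    proof -
      have "(\<Sum>k\<in>UNIV. a k) = (\<Sum>k\<in>UNIV. \<bar>w \<bullet> v k\<bar>) - ?n * r * norm w"
        by (simp add: a_def sum_subtractf)
      moreover have "(\<Sum>k\<in>UNIV. a k) = a i + (\<Sum>k\<in>UNIV - {i}. a k)" by (rule sum.remove) auto
      ultimately show ?thesis
        using norm_le_sum_inner_basis[OF v, of w] w(2) by (simp add: a_def)
    qed
    finally have "norm w / 2 / ?n \<le> (\<Sum>k\<in>UNIV - {i}. a k) / ?n" by (rule divide_right_mono) simp
    also have "\<dots> = (\<integral>z. \<phi> z \<partial>\<mu>)"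
    proof -
      have "(\<integral>z. \<phi> z \<partial>\<mu>) = (\<Sum>k\<in>UNIV - {i}. \<integral>z. a k * indicator (D k) z \<partial>\<mu>)"
        unfolding \<phi>_def using ind by (intro Bochner_Integration.integral_sum) auto
      then show ?thesis by (simp add: mass sum_divide_distrib)
    qed
    also have "\<dots> \<le> (\<integral>z. G (x, z) + G (y, z) \<partial>\<mu>)"
    proof (rule integral_mono_AE)
      show "integrable \<mu> \<phi>" unfolding \<phi>_def using ind by (intro Bochner_Integration.integrable_sum) auto
      show "AE z in \<mu>. \<phi> z \<le> G (x, z) + G (y, z)"
        using ae
      proof eventually_elim
        case (elim z)
        then obtain j where z: "z \<in> D j" by auto
        have "indicator (D k) z = (if k = j then 1 else 0 :: real)" for k
          using dis z by (auto simp: disjoint_family_on_def indicator_def)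
        then have \<phi>: "\<phi> z = (if i = j then 0 else a j)"
          by (simp add: \<phi>_def if_distrib[of "times _"] cong: if_cong)
        have "a j \<le> \<bar>w \<bullet> z\<bar>"
          using double_cap_inner_diff[of z "v j" r w] z by (simp add: a_def D_def)
        also have "\<dots> \<le> \<bar>x \<bullet> z\<bar> + \<bar>y \<bullet> z\<bar>"
          using w(1) by (auto simp: inner_add_left inner_diff_left)
        finally show ?case
          using \<phi> cell_sep_eq[OF dis x z] cell_sep_eq[OF dis y z] by (simp add: G_def)
      qed
    qed (use sec x y in simp)
    also have "\<dots> = g x + g y" unfolding g_def using sec x y by simp
    finally have "norm w \<le> 2 * ?n * (g x + g y)" by (simp add: field_simps)
    then have "c * norm w \<le> c * (2 * ?n * (g x + g y))" using c by (intro mult_left_mono) auto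
    moreover have "Lam_pow (ereal p) x y \<le> c * norm w"
      unfolding c_def using DS x y w p by (intro Lam_pow_le_chord) auto
    ultimately show ?thesis by (simp add: algebra_simps)
  qed

  \<comment> \<open>The function \<open>g x + g y\<close> restricted to pairs in one cap, arranged
    as products so that Fubini gives the factor \<open>1 / n\<close> for the other variable.\<close>
  define H where "H k z = indicator (D k) (fst z) * g (fst z) * indicator (D k) (snd z)
    + indicator (D k) (fst z) * (indicator (D k) (snd z) * g (snd z))" for k z
  have ig: "integrable \<mu> (\<lambda>x. indicator (D k) x * g x)" for k
    using integrable_mult_indicator[OF D gi] by simp
  have H: "integrable (\<mu> \<Otimes>\<^sub>M \<mu>) (H k)"
    "(\<integral>z. H k z \<partial>(\<mu> \<Otimes>\<^sub>M \<mu>)) = 2 / ?n * (\<integral>x. indicator (D k) x * g x \<partial>\<mu>)" for k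
    unfolding H_def
    using integral_pair_mult[OF ig[of k] ind[of k]] integral_pair_mult[OF ind[of k] ig[of k]]
    by (simp_all add: mass)
  have sg: "(\<Sum>k\<in>UNIV. \<integral>x. indicator (D k) x * g x \<partial>\<mu>) = (\<integral>x. g x \<partial>\<mu>)"
  proof -
    have "(\<Sum>k\<in>UNIV. \<integral>x. indicator (D k) x * g x \<partial>\<mu>) = (\<integral>x. (\<Sum>k\<in>UNIV. g x * indicator (D k) x) \<partial>\<mu>)"
      using ig by (subst Bochner_Integration.integral_sum) (simp_all add: mult.commute)
    also have "\<dots> = (\<integral>x. g x \<partial>\<mu>)"
    proof (rule integral_cong_AE)
      show "AE x in \<mu>. (\<Sum>k\<in>UNIV. g x * indicator (D k) x) = g x"
        using ae
      proof eventually_elim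
        case (elim x)
        then obtain j where "x \<in> D j" by auto
        with dis show ?case by (intro sum_indicator_disjoint_family) auto
      qed
      show "(\<lambda>x. \<Sum>k\<in>UNIV. g x * indicator (D k) x) \<in> borel_measurable \<mu>"
        using borel_measurable_integrable[OF gi] by measurable
    qed (use gi in simp)
    finally show ?thesis .
  qed
  \<comment> \<open>A majorant of the kernel: the first two terms act across caps, the last one
    inside a cap, where it is the bound \<open>key\<close>.\<close>
  define B where "B z = cell_sep D (fst z) (snd z) - 2 / pi * G z + 2 * ?n * c * (\<Sum>k\<in>UNIV. H k z)" for z
  have "(\<integral>z. Lam_pow (ereal p) (fst z) (snd z) \<partial>(\<mu> \<Otimes>\<^sub>M \<mu>)) \<le> (\<integral>z. B z \<partial>(\<mu> \<Otimes>\<^sub>M \<mu>))"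
  proof (rule integral_mono_AE)
    show "integrable (\<mu> \<Otimes>\<^sub>M \<mu>) (\<lambda>z. Lam_pow (ereal p) (fst z) (snd z))"
      using p by (intro Lam_pow_integrable \<mu>) simp
    show "integrable (\<mu> \<Otimes>\<^sub>M \<mu>) B" unfolding B_def using cs Gi H by simp
    show "AE z in \<mu> \<Otimes>\<^sub>M \<mu>. Lam_pow (ereal p) (fst z) (snd z) \<le> B z"
      using ae2
    proof eventually_elim
      case (elim z)
      obtain x y where z: "z = (x, y)" by (cases z)
      then obtain i j where ij: "x \<in> D i" "y \<in> D j" using elim by auto
      have x: "indicator (D k) x = (if k = i then 1 else 0 :: real)"
        and y: "indicator (D k) y = (if k = j then 1 else 0 :: real)" for k
        using ij dis by (auto simp: disjoint_family_on_def indicator_def)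
      show ?case
      proof (cases "i = j")
        case True
        have "H k z = (if k = i then g x + g y else 0)" for k
          using True by (simp add: H_def z x y)
        then show ?thesis
          using key[of x i y] ij True cell_sep_eq[OF dis ij] by (simp add: B_def G_def z)
      next
        case False
        have "H k z = 0" for k using False by (simp add: H_def z x y)
        \<comment> \<open>Across caps the exponent is lowered to 1, where the linear loss estimate
          applies.\<close>
        moreover have "Lam_pow (ereal p) x y \<le> Lam_pow 1 x y"
          using DS ij p by (intro Lam_pow_antimono) auto
        moreover have "Lam_pow 1 x y = Lam x y"
          using Lam_nonneg[OF DS DS, OF ij] by (simp add: Lam_pow_def)
        ultimately show ?thesis
          using False cell_sep_eq[OF dis ij] Lam_le_one_minus_inner[OF DS DS, OF ij] by (simp add: B_def G_def z)
      qed
    qed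
  qed
  also have "\<dots> = (1 - 1 / ?n) - 2 / pi * (\<integral>x. g x \<partial>\<mu>) + 2 * ?n * c * (2 / ?n * (\<integral>x. g x \<partial>\<mu>))"
  proof -
    have "(\<integral>z. cell_sep D (fst z) (snd z) \<partial>(\<mu> \<Otimes>\<^sub>M \<mu>)) = 1 - (\<Sum>i\<in>(UNIV :: 'n set). (prob (D i))\<^sup>2)"
      by (intro integral_cell_sep(2) D)
    also have "\<dots> = 1 - 1 / ?n" by (simp add: mass power2_eq_square)
    finally have 1: "(\<integral>z. cell_sep D (fst z) (snd z) \<partial>(\<mu> \<Otimes>\<^sub>M \<mu>)) = 1 - 1 / ?n" .
    have 2: "(\<integral>z. (\<Sum>k\<in>UNIV. H k z) \<partial>(\<mu> \<Otimes>\<^sub>M \<mu>)) = 2 / ?n * (\<integral>x. g x \<partial>\<mu>)"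
      using H by (simp only: Bochner_Integration.integral_sum H(2) sum_distrib_left[symmetric] sg)
    have 3: "integrable (\<mu> \<Otimes>\<^sub>M \<mu>) (\<lambda>z. \<Sum>k\<in>UNIV. H k z)" using H by simp
    show ?thesis unfolding B_def using cs Gi 3 1 2 gG by simp
  qed
  \<comment> \<open>Gain and loss are now multiples of the same integral, namely
    \<open>4 * c\<close> and \<open>2 / pi\<close>; the assumed bound \<open>1 / (2 * pi)\<close> on
    \<open>c\<close> is what makes the loss win.\<close>
  also have "\<dots> = (1 - 1 / ?n) + (4 * c - 2 / pi) * (\<integral>x. g x \<partial>\<mu>)"
  proof -
    have "2 * ?n * c * (2 / ?n * X) = 4 * c * X" for X by simp
    then show ?thesis by (simp only: left_diff_distrib)
  qed
  also have "\<dots> \<le> 1 - 1 / ?n"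
  proof -
    have "4 * c \<le> 4 * (1 / (2 * pi))" using c(2) by (rule mult_left_mono) simp
    then have "4 * c - 2 / pi \<le> 0" by simp
    from mult_nonpos_nonneg[OF this g0] show ?thesis by linarith
  qed
  finally show ?thesis using energy_eq_pair[OF \<mu>, of "ereal p"] p by simp
qed

subsection \<open>Transport of cap masses\<close>

lemma couplingsD:
  fixes \<gamma> :: "((real ^ 'n) \<times> (real ^ 'n)) measure"
  assumes "\<gamma> \<in> couplings \<mu> \<nu>"
  shows "prob_space \<gamma>" "sets \<gamma> = sets (sphere_borel \<Otimes>\<^sub>M sphere_borel)"
    "space \<gamma> = sphere 0 1 \<times> sphere 0 1"
    "distr \<gamma> sphere_borel fst = \<mu>" "distr \<gamma> sphere_borel snd = \<nu>"
  using assms sets_eq_imp_space_eq[of \<gamma> "sphere_borel \<Otimes>\<^sub>M sphere_borel"]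
  by (auto simp: couplings_def space_pair_measure)

text \<open>The product measure is a coupling. Nonemptiness is what makes the real infimum in
  \<open>d_inf\<close> meaningful.\<close>

lemma couplings_nonempty:
  fixes \<mu> \<nu> :: "(real ^ 'n) measure"
  assumes "\<mu> \<in> sphere_probs" "\<nu> \<in> sphere_probs"
  shows "couplings \<mu> \<nu> \<noteq> {}"
proof -
  interpret M: prob_space \<mu> using sphere_probsD[OF assms(1)] by simp
  interpret N: prob_space \<nu> using sphere_probsD[OF assms(2)] by simp
  interpret P: pair_prob_space \<mu> \<nu> ..
  note s = sphere_probsD(2)[OF assms(1)] sphere_probsD(2)[OF assms(2)]
  have "sets (\<mu> \<Otimes>\<^sub>M \<nu>) = sets (sphere_borel \<Otimes>\<^sub>M sphere_borel)"
    using s by (intro sets_pair_measure_cong)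
  moreover have "distr (\<mu> \<Otimes>\<^sub>M \<nu>) sphere_borel fst = distr (\<mu> \<Otimes>\<^sub>M \<nu>) \<mu> fst"
    using s by (intro distr_cong) auto
  then have "distr (\<mu> \<Otimes>\<^sub>M \<nu>) sphere_borel fst = \<mu>" by (simp add: N.distr_pair_fst)
  moreover have "distr (\<mu> \<Otimes>\<^sub>M \<nu>) sphere_borel snd = distr (\<mu> \<Otimes>\<^sub>M \<nu>) \<nu> snd"
    using s by (intro distr_cong) auto
  moreover have "distr (\<mu> \<Otimes>\<^sub>M \<nu>) \<nu> snd = \<nu>"
  proof (rule measure_eqI)
    fix A assume A: "A \<in> sets (distr (\<mu> \<Otimes>\<^sub>M \<nu>) \<nu> snd)"
    then have "snd -` A \<inter> space (\<mu> \<Otimes>\<^sub>M \<nu>) = space \<mu> \<times> A"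
      by (auto simp: space_pair_measure dest: sets.sets_into_space)
    with A show "emeasure (distr (\<mu> \<Otimes>\<^sub>M \<nu>) \<nu> snd) A = emeasure \<nu> A"
      by (simp add: emeasure_distr N.emeasure_pair_measure_Times M.emeasure_space_1)
  qed simp
  ultimately have "\<mu> \<Otimes>\<^sub>M \<nu> \<in> couplings \<mu> \<nu>"
    using P.prob_space_axioms by (simp add: couplings_def)
  then show ?thesis by blast
qed

lemma openin_sphere_pair_measurable:
  fixes \<gamma> :: "((real ^ 'n) \<times> (real ^ 'n)) measure"
  assumes "\<gamma> \<in> couplings \<mu> \<nu>" "openin (top_of_set (space \<gamma>)) U"
  shows "U \<in> sets \<gamma>"
proof -
  obtain T where T: "open T" "U = space \<gamma> \<inter> T" using assms(2) by (auto simp: openin_open)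
  have "(\<lambda>z. z) -` T \<inter> space (sphere_borel \<Otimes>\<^sub>M sphere_borel) \<in> sets (sphere_borel \<Otimes>\<^sub>M sphere_borel :: ((real ^ 'n) \<times> (real ^ 'n)) measure)"
    using T by (intro measurable_sets[OF measurable_pair_sphere_borel]) auto
  then show ?thesis
    using T couplingsD(2)[OF assms(1)] sets_eq_imp_space_eq[OF couplingsD(2)[OF assms(1)]]
    by (simp add: Int_commute)
qed

text \<open>The support is an intersection of possibly uncountably many sets of full measure. By
  Lindelof the union of their open complements is a countable union of null sets.\<close>

lemma AE_in_spt:
  fixes \<gamma> :: "((real ^ 'n) \<times> (real ^ 'n)) measure"
  assumes \<gamma>: "\<gamma> \<in> couplings \<mu> \<nu>"
  shows "AE z in \<gamma>. z \<in> spt \<gamma>"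
proof -
  interpret prob_space \<gamma> by (rule couplingsD(1)[OF \<gamma>])
  define C where "C = {C. closedin (top_of_set (space \<gamma>)) C \<and> emeasure \<gamma> C = emeasure \<gamma> (space \<gamma>)}"
  define F where "F = (\<lambda>A. space \<gamma> - A) ` C"
  have op: "openin (top_of_set (space \<gamma>)) U" if "U \<in> F" for U
    using that openin_diff[of "top_of_set (space \<gamma>)" "space \<gamma>"] by (auto simp: F_def C_def)
  obtain F' where F': "F' \<subseteq> F" "countable F'" "\<Union>F' = \<Union>F"
    using Lindelof_openin[of F "space \<gamma>"] op by blast
  have null: "U \<in> null_sets \<gamma>" if U: "U \<in> F" for U
  proof -
    obtain A where A: "A \<in> C" "U = space \<gamma> - A" using U by (auto simp: F_def)
    have "A \<subseteq> space \<gamma>" using A closedin_subset by (force simp: C_def)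
    then have AU: "A = space \<gamma> - U" using A by auto
    have Um: "U \<in> events" by (rule openin_sphere_pair_measurable[OF \<gamma> op[OF U]])
    have "emeasure \<gamma> A = 1" using A by (simp add: C_def emeasure_space_1)
    then have "prob A = 1" by (simp add: measure_def)
    then have "prob U = 0" using prob_compl[OF Um] AU by simp
    then show ?thesis using Um by (simp add: emeasure_eq_measure null_sets_def)
  qed
  have "\<Union>F' \<in> null_sets \<gamma>"
    using null F' by (intro null_sets_UN'[of F' "\<lambda>x. x", simplified]) auto
  then have "AE z in \<gamma>. z \<notin> \<Union>F" using F' by (metis AE_not_in)
  then show ?thesis
    using AE_space
  proof eventually_elim
    case (elim z)
    then have "z \<in> \<Inter>C" by (auto simp: F_def)
    then show ?case by (simp add: spt_def C_def)
  qed
qed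

lemma d_inf_less_coupling:
  fixes \<mu> \<nu> :: "(real ^ 'n) measure"
  assumes \<mu>: "\<mu> \<in> sphere_probs" and \<nu>: "\<nu> \<in> sphere_probs" and d: "d_inf \<mu> \<nu> < \<delta>"
  obtains \<gamma> where "\<gamma> \<in> couplings \<mu> \<nu>" "AE z in \<gamma>. norm (fst z - snd z) < \<delta>"
proof -
  let ?f = "\<lambda>\<gamma> :: ((real ^ 'n) \<times> (real ^ 'n)) measure. SUP (x, y)\<in>spt \<gamma>. geo_dist x y"
  have "?f ` couplings \<mu> \<nu> \<noteq> {}" using couplings_nonempty[OF \<mu> \<nu>] by simp
  then obtain \<gamma> where \<gamma>: "\<gamma> \<in> couplings \<mu> \<nu>" "?f \<gamma> < \<delta>"
    using cInf_lessD[of "?f ` couplings \<mu> \<nu>" \<delta>] d unfolding d_inf_def by blast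
  interpret prob_space \<gamma> by (rule couplingsD(1)[OF \<gamma>(1)])
  have sub: "spt \<gamma> \<subseteq> sphere 0 1 \<times> sphere 0 1"
    using couplingsD(3)[OF \<gamma>(1)] closedin_topspace[of "top_of_set (space \<gamma>)"] unfolding spt_def by auto
  \<comment> \<open>A real supremum bounds its elements only if the set is bounded above;
    \<open>pi\<close> is such a bound.\<close>
  have bdd: "bdd_above ((\<lambda>(x, y). geo_dist x y) ` spt \<gamma>)"
  proof (rule bdd_aboveI2)
    fix z assume "z \<in> spt \<gamma>"
    then have "fst z \<in> sphere 0 1" "snd z \<in> sphere 0 1" using sub by auto
    then show "(\<lambda>(x, y). geo_dist x y) z \<le> pi"
      using geo_dist_bounds(2) by (simp add: split_beta)
  qed
  have "AE z in \<gamma>. norm (fst z - snd z) < \<delta>"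
    using AE_in_spt[OF \<gamma>(1)]
  proof eventually_elim
    case (elim z)
    then have "fst z \<in> sphere 0 1" "snd z \<in> sphere 0 1" using sub by auto
    from dist_sphere_le_geo_dist[OF this] have "norm (fst z - snd z) \<le> (\<lambda>(x, y). geo_dist x y) z"
      by (simp add: split_beta)
    also have "\<dots> \<le> ?f \<gamma>" by (rule cSUP_upper[OF elim bdd])
    finally show ?case using \<gamma>(2) by simp
  qed
  with \<gamma>(1) show ?thesis by (rule that)
qed

text \<open>Under a good coupling almost no point moves by \<delta> or more, so the preimage of
  \<open>A\<close> under one projection lies, up to a null set, in that of \<open>B\<close> under
  the other. Having both directions avoids a symmetry argument for \<open>d_inf\<close>.\<close>

lemma d_inf_less_measure_le:
  fixes \<mu> \<nu> :: "(real ^ 'n) measure"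
  assumes \<mu>: "\<mu> \<in> sphere_probs" and \<nu>: "\<nu> \<in> sphere_probs" and d: "d_inf \<mu> \<nu> < \<delta>"
    and A: "A \<in> sets sphere_borel" and B: "B \<in> sets sphere_borel"
    and near: "\<And>x y. x \<in> A \<Longrightarrow> y \<in> sphere 0 1 \<Longrightarrow> norm (x - y) < \<delta> \<Longrightarrow> y \<in> B"
  shows "measure \<mu> A \<le> measure \<nu> B" "measure \<nu> A \<le> measure \<mu> B"
proof -
  obtain \<gamma> where \<gamma>: "\<gamma> \<in> couplings \<mu> \<nu>" "AE z in \<gamma>. norm (fst z - snd z) < \<delta>"
    using d_inf_less_coupling[OF \<mu> \<nu> d] .
  note c = couplingsD[OF \<gamma>(1)]
  interpret prob_space \<gamma> by (rule c(1))
  have [measurable]: "fst \<in> measurable \<gamma> sphere_borel" "snd \<in> measurable \<gamma> sphere_borel"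
    using c(2) measurable_cong_sets[OF c(2) refl] measurable_fst measurable_snd by blast+
  have m: "measure \<mu> E = prob (fst -` E \<inter> space \<gamma>)" "measure \<nu> E = prob (snd -` E \<inter> space \<gamma>)"
    if "E \<in> sets sphere_borel" for E
    using that c(4,5) measure_distr[of fst \<gamma> sphere_borel E] measure_distr[of snd \<gamma> sphere_borel E]
    by auto
  have ms: "fst -` E \<inter> space \<gamma> \<in> events" "snd -` E \<inter> space \<gamma> \<in> events" if "E \<in> sets sphere_borel" for E
    using that by (auto intro: measurable_sets)
  show "measure \<mu> A \<le> measure \<nu> B"
    unfolding m(1)[OF A] m(2)[OF B]
  proof (rule finite_measure_mono_AE)
    show "AE z in \<gamma>. z \<in> fst -` A \<inter> space \<gamma> \<longrightarrow> z \<in> snd -` B \<inter> space \<gamma>"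
      using \<gamma>(2) AE_space by eventually_elim (use c(3) near in auto)
  qed (rule ms[OF B])
  show "measure \<nu> A \<le> measure \<mu> B"
    unfolding m(2)[OF A] m(1)[OF B]
  proof (rule finite_measure_mono_AE)
    show "AE z in \<gamma>. z \<in> snd -` A \<inter> space \<gamma> \<longrightarrow> z \<in> fst -` B \<inter> space \<gamma>"
      using \<gamma>(2) AE_space by eventually_elim (use c(3) near in \<open>auto simp: norm_minus_commute\<close>)
  qed (rule ms[OF B])
qed

lemma double_cap_enlarge:
  assumes "x \<in> double_cap u r" "y \<in> sphere 0 1" "norm (x - y) < \<delta>"
  shows "y \<in> double_cap u (r + \<delta>)"
  using assms norm_triangle_ineq[of "y - x" "x - u"] norm_triangle_ineq[of "y - x" "x + u"]
  by (auto simp: double_cap_def norm_minus_commute)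

section \<open>The threshold exponent and the failure of continuity\<close>

text \<open>The witness is the infimum of the exponents at which some simplex measure is optimal.
  For uniqueness, an exponent strictly between two candidates would make the nonempty set of simplex
  measures both equal to and disjoint from the set of maximizers.\<close>

lemma threshold_exponent_props:
  assumes n: "2 \<le> CARD('n::finite)"
  shows "1 \<le> threshold_exponent TYPE('n)"
    and "\<And>\<alpha>. 0 < \<alpha> \<Longrightarrow> \<alpha> < threshold_exponent TYPE('n) \<Longrightarrow>
      (simplex_probs :: (real ^ 'n) measure set) \<inter> energy_argmax \<alpha> = {}"
    and "\<And>\<alpha>. threshold_exponent TYPE('n) < \<alpha> \<Longrightarrow>
      (simplex_probs :: (real ^ 'n) measure set) = energy_argmax \<alpha>"
proof -
  define P where "P a \<longleftrightarrow> 1 \<le> a \<and>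
     (\<forall>\<alpha>. 0 < \<alpha> \<and> \<alpha> < a \<longrightarrow> (simplex_probs :: (real ^ 'n) measure set) \<inter> energy_argmax \<alpha> = {}) \<and>
     (\<forall>\<alpha>. a < \<alpha> \<longrightarrow> (simplex_probs :: (real ^ 'n) measure set) = energy_argmax \<alpha>)" for a :: ereal
  define A where "A = {\<alpha>. 0 < \<alpha> \<and> (simplex_probs :: (real ^ 'n) measure set) \<inter> energy_argmax \<alpha> \<noteq> {}}"
  have "1 \<le> Inf A"
  proof (intro Inf_greatest leI notI)
    show False if "\<alpha> \<in> A" "\<alpha> < 1" for \<alpha>
      using that simplex_not_argmax[OF n, of \<alpha>] by (simp add: A_def)
  qed
  moreover have "(simplex_probs :: (real ^ 'n) measure set) \<inter> energy_argmax \<alpha> = {}" if "0 < \<alpha>" "\<alpha> < Inf A" for \<alpha>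
  proof -
    have "\<alpha> \<notin> A" using that(2) Inf_lower[of \<alpha> A] leD by blast
    then show ?thesis using that(1) by (simp add: A_def)
  qed
  moreover have "(simplex_probs :: (real ^ 'n) measure set) = energy_argmax \<alpha>" if a: "Inf A < \<alpha>" for \<alpha>
  proof -
    obtain \<beta> where "\<beta> \<in> A" "\<beta> < \<alpha>" using a by (auto simp: Inf_less_iff)
    then show ?thesis using simplex_argmax_mono[of _ \<beta> \<alpha>] by (auto simp: A_def)
  qed
  ultimately have ex: "P (Inf A)" by (auto simp: P_def)
  have le: "a \<le> b" if "P a" "P b" for a b
  proof (rule ccontr)
    assume "\<not> a \<le> b"
    then obtain c where c: "b < c" "c < a" using dense[of b a] not_le by blast
    have "0 < c" using that(2) c by (auto simp: P_def intro: less_le_trans[of 0 1] less_trans)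
    then show False using that c simplex_probs_nonempty[where 'n = 'n] by (auto simp: P_def)
  qed
  have "threshold_exponent TYPE('n) = (THE a. P a)" by (simp add: threshold_exponent_def P_def)
  moreover have "P (THE a. P a)" by (rule theI[of P, OF ex]) (use le ex in \<open>auto intro: antisym\<close>)
  ultimately have "P (threshold_exponent TYPE('n))" by simp
  then show "1 \<le> threshold_exponent TYPE('n)"
    and "\<And>\<alpha>. 0 < \<alpha> \<Longrightarrow> \<alpha> < threshold_exponent TYPE('n) \<Longrightarrow>
      (simplex_probs :: (real ^ 'n) measure set) \<inter> energy_argmax \<alpha> = {}"
    and "\<And>\<alpha>. threshold_exponent TYPE('n) < \<alpha> \<Longrightarrow>
      (simplex_probs :: (real ^ 'n) measure set) = energy_argmax \<alpha>"
    unfolding P_def by blast+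
qed

theorem corollary2p6:
  fixes d :: nat
  assumes "d \<ge> 1" and "CARD('n::finite) = d + 1"
    and "threshold_exponent TYPE('n) \<noteq> 1"
  shows "\<not> (\<exists>\<mu> :: real \<Rightarrow> (real ^ 'n) measure.
           (\<forall>\<alpha>>0. \<mu> \<alpha> \<in> energy_argmax (ereal \<alpha>)) \<and>
           d_inf_continuous_at \<mu> (threshold_exponent TYPE('n)))"
proof
  assume "\<exists>\<mu> :: real \<Rightarrow> (real ^ 'n) measure. (\<forall>\<alpha>>0. \<mu> \<alpha> \<in> energy_argmax (ereal \<alpha>)) \<and>
           d_inf_continuous_at \<mu> (threshold_exponent TYPE('n))"
  then obtain \<mu> :: "real \<Rightarrow> (real ^ 'n) measure"
    where opt: "\<And>\<alpha>. 0 < \<alpha> \<Longrightarrow> \<mu> \<alpha> \<in> energy_argmax (ereal \<alpha>)"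
      and cont: "d_inf_continuous_at \<mu> (threshold_exponent TYPE('n))" by blast
  have n: "2 \<le> CARD('n)" using assms by simp
  note thr = threshold_exponent_props[OF n]
  obtain t where t: "0 < t" "threshold_exponent TYPE('n) = ereal t"
      "((\<lambda>\<alpha>. d_inf (\<mu> \<alpha>) (\<mu> t)) \<longlongrightarrow> 0) (at t within {0<..})"
    using cont by (auto simp: d_inf_continuous_at_def)
  have "1 < t" using thr(1) assms(3) t(2) by (auto simp: one_ereal_def order_less_le)
  \<comment> \<open>Chosen before \<open>r\<close>, so that the cap radius does not depend on how
    close to \<open>t\<close> the exponent \<open>a\<close> will be.\<close>
  define p where "p = (1 + t) / 2"
  have p: "1 < p" "p < t" using \<open>1 < t\<close> by (auto simp: p_def)
  have prob: "\<mu> \<alpha> \<in> sphere_probs" if "0 < \<alpha>" for \<alpha> using opt[OF that] by (simp add: energy_argmax_def)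

  have "((\<lambda>r. 2 * (4 * r) powr (p - 1)) \<longlongrightarrow> 2 * (4 * 0) powr (p - 1)) (at_right 0)"
    using p by (intro tendsto_intros tendsto_powr') (auto simp: eventually_at_right_field intro: exI[of _ 1])
  then have "eventually (\<lambda>r. 2 * (4 * r) powr (p - 1) < 1 / (2 * pi)) (at_right (0 :: real))"
    by (rule order_tendstoD) simp
  moreover have "eventually (\<lambda>r. r < 1 / (2 * real CARD('n))) (at_right (0 :: real))"
    by (rule eventually_at_rightI[of _ "1 / (2 * real CARD('n))"]) auto
  ultimately have "eventually (\<lambda>r. 2 * (4 * r) powr (p - 1) < 1 / (2 * pi) \<and> r < 1 / (2 * real CARD('n)) \<and> 0 < r) (at_right (0 :: real))"
    using eventually_at_right_less[of "0 :: real"] by eventually_elim simp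
  then obtain r :: real where r: "0 < r" "r < 1 / (2 * real CARD('n))" "2 * (4 * r) powr (p - 1) < 1 / (2 * pi)"
    using eventually_happens[of _ "at_right (0 :: real)"] by auto
  have nr: "real CARD('n) * r < 1 / 2" using r(2) by (simp add: field_simps)

  \<comment> \<open>Mass is moved twice, from \<open>\<mu> b\<close> to \<open>\<mu> t\<close> and
    on to \<open>\<mu> a\<close>; two moves of length below \<open>r / 3\<close> stay within the cap
    of radius \<open>r\<close>.\<close>
  have "eventually (\<lambda>\<alpha>. d_inf (\<mu> \<alpha>) (\<mu> t) < r / 3) (at t within {0<..})"
    using t(3) r(1) by (intro order_tendstoD(2)) auto
  then obtain \<epsilon> where \<epsilon>: "0 < \<epsilon>" "\<And>\<alpha>. 0 < \<alpha> \<Longrightarrow> \<alpha> \<noteq> t \<Longrightarrow> dist \<alpha> t < \<epsilon> \<Longrightarrow> d_inf (\<mu> \<alpha>) (\<mu> t) < r / 3"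
    by (auto simp: eventually_at)
  \<comment> \<open>The maximum keeps \<open>a\<close> above \<open>p\<close>, so that the estimate
    at exponent \<open>p\<close> bounds the energy at \<open>a\<close>.\<close>
  define a where "a = max p (t - \<epsilon> / 2)"
  define b where "b = t + \<epsilon> / 2"
  have a: "0 < a" "a < t" "p \<le> a" "d_inf (\<mu> a) (\<mu> t) < r / 3"
    using p \<epsilon> by (auto simp: a_def dist_real_def)
  have b: "t < b" "d_inf (\<mu> b) (\<mu> t) < r / 3"
    using t(1) \<epsilon> by (auto simp: b_def dist_real_def)

  have "\<mu> b \<in> simplex_probs" using thr(3)[of "ereal b"] opt[of b] b t by simp
  then obtain v where v: "orthonormal_basis v" "\<And>i. measure (\<mu> b) {v i, - v i} = 1 / real CARD('n)"
    by (auto simp: simplex_probs_def)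
  have cap: "1 / real CARD('n) \<le> measure (\<mu> a) (double_cap (v i) r)" for i
  proof -
    note vS = orthonormal_basisD(3)[OF v(1), of i]
    have 1: "{v i, - v i} \<in> sets sphere_borel" using vS by (intro finite_in_sphere_borel) auto
    have "measure (\<mu> b) {v i, - v i} \<le> measure (\<mu> t) (double_cap (v i) (r / 3))"
    proof (rule d_inf_less_measure_le(1)[OF prob prob b(2) 1 double_cap_in_sphere_borel])
      show "y \<in> double_cap (v i) (r / 3)" if "x \<in> {v i, - v i}" "y \<in> sphere 0 1" "norm (x - y) < r / 3" for x y
        using that norm_minus_cancel[of "v i + y"]
        by (auto simp: double_cap_def norm_minus_commute add.commute simp del: norm_minus_cancel)
    qed (use t b in auto)
    also have "\<dots> \<le> measure (\<mu> a) (double_cap (v i) (r / 3 + r / 3))"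
      using a(1) t(1)
      by (rule d_inf_less_measure_le(2)[OF prob prob a(4) double_cap_in_sphere_borel double_cap_in_sphere_borel])
        (assumption | rule double_cap_enlarge)+
    also have "\<dots> \<le> measure (\<mu> a) (double_cap (v i) r)"
    proof -
      interpret prob_space "\<mu> a" using sphere_probsD[OF prob[OF a(1)]] by simp
      show ?thesis
        using double_cap_in_sphere_borel[of "v i" r] sphere_probsD(2)[OF prob[OF a(1)]] r(1)
        by (intro finite_measure_mono) (auto simp: double_cap_def)
    qed
    finally show ?thesis using v(2) by simp
  qed
  have "energy (ereal a) (\<mu> a) \<le> energy (ereal p) (\<mu> a)"
    using p a by (intro energy_antimono prob) auto
  also have "\<dots> \<le> 1 / 2 * (1 - 1 / real CARD('n))"
    using r nr p by (intro energy_near_simplex_le[OF prob[OF a(1)] v(1) cap]) auto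
  finally have le: "energy (ereal a) (\<mu> a) \<le> 1 / 2 * (1 - 1 / real CARD('n))" .
  \<comment> \<open>The optimal energy at \<open>a\<close> does not exceed the exponent-independent
    simplex value, which \<open>\<mu> b\<close> attains.\<close>
  have "\<mu> b \<in> energy_argmax (ereal a)"
    unfolding energy_argmax_def
  proof (intro CollectI conjI ballI)
    show "\<mu> b \<in> sphere_probs" using b t by (intro prob) simp
    fix \<nu> :: "(real ^ 'n) measure" assume "\<nu> \<in> sphere_probs"
    then have "energy (ereal a) \<nu> \<le> energy (ereal a) (\<mu> a)"
      using opt[OF a(1)] by (simp add: energy_argmax_def)
    then show "energy (ereal a) \<nu> \<le> energy (ereal a) (\<mu> b)"
      using le energy_simplex[OF \<open>\<mu> b \<in> simplex_probs\<close>, of "ereal a"] a(1) by simp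
  qed
  then show False
    using thr(2)[of "ereal a"] a t \<open>\<mu> b \<in> simplex_probs\<close> by auto
qed

end
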